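(* Let $\omega$ be a translation invariant Kolmogorov state of ${\cal B}$ and let $\lambda\in\mathbb{C}^d$ be a unit vector. Then $({\cal B},\theta,\omega)$ is weakly isomorphic to the Bernoulli dynamics $({\cal B},\theta,\omega_\lambda)$: there is a unitary $U:{\cal H}_\omega\to{\cal H}_{\omega_\lambda}$ with $U\zeta_\omega=\zeta_{\omega_\lambda}$ and $US_\omega U^*=S_{\omega_\lambda}$.
   Context: ${\cal B}=\bigotimes_{j\in\mathbb{Z}}M_d^{(j)}(\mathbb{C})$ ($d\ge2$), $\theta$ the right translation $\theta(Q^{(j)})=Q^{(j+1)}$, ${\cal B}_R={\cal B}_{[1,\infty)}$ the $C^*$-subalgebra generated by the sites $j\ge1$. For a translation invariant state $\omega$: GNS triple $({\cal H}_\omega,\pi_\omega,\zeta_\omega)$, unitary $S_\omega\pi_\omega(x)\zeta_\omega=\pi_\omega(\theta(x))\zeta_\omega$, $E_{n]}$ = projection onto the closed span of $\pi_\omega(\theta^n({\cal B}_R))'\zeta_\omega$; $\omega$ is Kolmogorov if $E_{n]}\to|\zeta_\omega\rangle\langle\zeta_\omega|$ strongly as $n\to-\infty$. For a unit vector $\lambda\in\mathbb{C}^d$, $\rho_\lambda$ is the vector state $\rho_\lambda(Q)=\langle\lambda,Q\lambda\rangle$ of $M_d(\mathbb{C})$ and $\omega_\lambda=\bigotimes_{j\in\mathbb{Z}}\rho_\lambda$ is the associated (pure, translation invariant) product state of ${\cal B}$. *)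

theory Defs
  imports "HOL-Analysis.Analysis"
begin

text \<open>The one-site algebra is M_d(C) with d = CARD('d), 'd a finite type.
  A configuration is a function int => 'd.  An element A (x) 1 of the local
  algebra B_Lambda (Lambda finite) is represented by its matrix entries
  M sigma tau in the product basis: M sigma tau vanishes unless sigma and tau
  agree off Lambda, and otherwise depends only on sigma, tau restricted to Lambda.\<close>

type_synonym 'd obs = "(int \<Rightarrow> 'd) \<Rightarrow> (int \<Rightarrow> 'd) \<Rightarrow> complex"

definition local_obs :: "int set \<Rightarrow> 'd obs \<Rightarrow> bool" where
  "local_obs L M \<longleftrightarrow> finite L \<and>
     (\<forall>s t. M s t \<noteq> 0 \<longrightarrow> (\<forall>j. j \<notin> L \<longrightarrow> s j = t j)) \<and>
     (\<forall>s t s' t'. (\<forall>j\<in>L. s j = s' j \<and> t j = t' j) \<and>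
                 (\<forall>j. j \<notin> L \<longrightarrow> s j = t j \<and> s' j = t' j) \<longrightarrow> M s t = M s' t')"

text \<open>The local *-algebra (union of the B_Lambda, Lambda finite), norm dense in B.\<close>
definition Bloc :: "'d obs set" where
  "Bloc = {M. \<exists>L. local_obs L M}"

text \<open>Local observables supported in [m, infinity): these generate theta^(m-1)(B_R).\<close>
definition Bloc_from :: "int \<Rightarrow> 'd obs set" where
  "Bloc_from m = {M. \<exists>L. L \<subseteq> {m..} \<and> local_obs L M}"

definition obs_one :: "'d obs" where
  "obs_one s t = (if s = t then 1 else 0)"

definition obs_add :: "'d obs \<Rightarrow> 'd obs \<Rightarrow> 'd obs" where
  "obs_add M N s t = M s t + N s t"

definition obs_scale :: "complex \<Rightarrow> 'd obs \<Rightarrow> 'd obs" where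
  "obs_scale c M s t = c * M s t"

definition obs_mult :: "'d obs \<Rightarrow> 'd obs \<Rightarrow> 'd obs" where
  "obs_mult M N s t = (\<Sum>r\<in>{r. M s r \<noteq> 0}. M s r * N r t)"

definition obs_adj :: "'d obs \<Rightarrow> 'd obs" where
  "obs_adj M s t = cnj (M t s)"

text \<open>The translation automorphism theta^n: theta(Q^(j)) = Q^(j+1).\<close>
definition shift :: "int \<Rightarrow> 'd obs \<Rightarrow> 'd obs" where
  "shift n M s t = M (\<lambda>j. s (j + n)) (\<lambda>j. t (j + n))"

text \<open>A state of B is determined by (and uniquely extends from) a positive,
  normalized linear functional on the dense local *-algebra.\<close>
definition is_state :: "('d obs \<Rightarrow> complex) \<Rightarrow> bool" where
  "is_state w \<longleftrightarrow>
     (\<forall>M\<in>Bloc. \<forall>N\<in>Bloc. w (obs_add M N) = w M + w N) \<and>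
     (\<forall>M\<in>Bloc. \<forall>c. w (obs_scale c M) = c * w M) \<and>
     (\<forall>M\<in>Bloc. Im (w (obs_mult (obs_adj M) M)) = 0 \<and> Re (w (obs_mult (obs_adj M) M)) \<ge> 0) \<and>
     w obs_one = 1"

definition translation_invariant :: "('d obs \<Rightarrow> complex) \<Rightarrow> bool" where
  "translation_invariant w \<longleftrightarrow> (\<forall>M\<in>Bloc. w (shift 1 M) = w M)"

text \<open>The product state omega_lambda = (x)_j rho_lambda, rho_lambda(Q) = <lambda, Q lambda>.\<close>
definition product_state :: "complex ^ 'd \<Rightarrow> 'd obs \<Rightarrow> complex" where
  "product_state lam M =
     (let L = (SOME L. local_obs L M);
          C = {s :: int \<Rightarrow> 'd. \<forall>j. j \<notin> L \<longrightarrow> s j = undefined}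
      in \<Sum>s\<in>C. \<Sum>t\<in>C. cnj (\<Prod>j\<in>L. lam $ (s j)) * M s t * (\<Prod>j\<in>L. lam $ (t j)))"

text \<open>A complex Hilbert space is modelled as a real Hilbert space 'h with a
  complex structure J (multiplication by i): J real-linear, J o J = -id,
  J orthogonal.\<close>
definition cplx_struct :: "('h::real_inner \<Rightarrow> 'h) \<Rightarrow> bool" where
  "cplx_struct J \<longleftrightarrow> linear J \<and> (\<forall>x. J (J x) = - x) \<and> (\<forall>x y. inner (J x) (J y) = inner x y)"

definition cscale :: "('h::real_vector \<Rightarrow> 'h) \<Rightarrow> complex \<Rightarrow> 'h \<Rightarrow> 'h" where
  "cscale J c x = Re c *\<^sub>R x + Im c *\<^sub>R J x"

text \<open>Complex inner product, antilinear in the first, linear in the second argument.\<close>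
definition cinner :: "('h::real_inner \<Rightarrow> 'h) \<Rightarrow> 'h \<Rightarrow> 'h \<Rightarrow> complex" where
  "cinner J x y = Complex (inner x y) (- inner x (J y))"

definition bcl :: "('h::real_normed_vector \<Rightarrow> 'h) \<Rightarrow> ('h \<Rightarrow> 'h) \<Rightarrow> bool" where
  "bcl J T \<longleftrightarrow> bounded_linear T \<and> (\<forall>x. T (J x) = J (T x))"

definition orth_proj :: "'h::real_inner set \<Rightarrow> 'h \<Rightarrow> 'h" where
  "orth_proj K v = (THE w. w \<in> K \<and> (\<forall>u\<in>K. inner (v - w) u = 0))"

definition unitary_map ::
  "('h1::real_normed_vector \<Rightarrow> 'h1) \<Rightarrow> ('h2::real_normed_vector \<Rightarrow> 'h2) \<Rightarrow> ('h1 \<Rightarrow> 'h2) \<Rightarrow> bool" where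
  "unitary_map J1 J2 U \<longleftrightarrow> bounded_linear U \<and> (\<forall>x. U (J1 x) = J2 (U x)) \<and> bij U \<and>
     (\<forall>x. norm (U x) = norm x)"

text \<open>(H, rep, zeta) is a GNS triple of the state w (rep given on the dense local
  *-algebra; it extends uniquely by continuity to B).\<close>
definition is_GNS ::
  "('d obs \<Rightarrow> complex) \<Rightarrow> ('h::{real_inner,complete_space} \<Rightarrow> 'h) \<Rightarrow> ('d obs \<Rightarrow> 'h \<Rightarrow> 'h) \<Rightarrow> 'h \<Rightarrow> bool" where
  "is_GNS w J rep z \<longleftrightarrow> cplx_struct J \<and>
     (\<forall>M\<in>Bloc. bcl J (rep M)) \<and>
     (\<forall>M\<in>Bloc. \<forall>N\<in>Bloc. \<forall>x. rep (obs_add M N) x = rep M x + rep N x) \<and>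
     (\<forall>M\<in>Bloc. \<forall>c x. rep (obs_scale c M) x = cscale J c (rep M x)) \<and>
     (\<forall>M\<in>Bloc. \<forall>N\<in>Bloc. \<forall>x. rep (obs_mult M N) x = rep M (rep N x)) \<and>
     (\<forall>M\<in>Bloc. \<forall>x y. inner (rep (obs_adj M) x) y = inner x (rep M y)) \<and>
     (\<forall>x. rep obs_one x = x) \<and>
     (\<forall>M\<in>Bloc. w M = cinner J z (rep M z)) \<and>
     closure {rep M z | M. M \<in> Bloc} = UNIV"

text \<open>S is the unitary S_omega rep(x) zeta = rep(theta x) zeta (it is uniquely
  determined by this on the dense set rep(Bloc) zeta).\<close>
definition is_shift_op ::
  "('h::real_normed_vector \<Rightarrow> 'h) \<Rightarrow> ('d obs \<Rightarrow> 'h \<Rightarrow> 'h) \<Rightarrow> 'h \<Rightarrow> ('h \<Rightarrow> 'h) \<Rightarrow> bool" where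
  "is_shift_op J rep z S \<longleftrightarrow> bcl J S \<and> (\<forall>M\<in>Bloc. S (rep M z) = rep (shift 1 M) z)"

text \<open>Commutant of rep(theta^n(B_R)), B_R generated by the sites j >= 1.\<close>
definition commutant_R ::
  "('h::real_normed_vector \<Rightarrow> 'h) \<Rightarrow> ('d obs \<Rightarrow> 'h \<Rightarrow> 'h) \<Rightarrow> int \<Rightarrow> ('h \<Rightarrow> 'h) set" where
  "commutant_R J rep n = {T. bcl J T \<and> (\<forall>M\<in>Bloc_from (n + 1). \<forall>x. T (rep M x) = rep M (T x))}"

definition E_proj ::
  "('h::{real_inner,complete_space} \<Rightarrow> 'h) \<Rightarrow> ('d obs \<Rightarrow> 'h \<Rightarrow> 'h) \<Rightarrow> 'h \<Rightarrow> int \<Rightarrow> 'h \<Rightarrow> 'h" where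
  "E_proj J rep z n = orth_proj (closure {T z | T. T \<in> commutant_R J rep n})"

definition kolmogorov ::
  "('h::{real_inner,complete_space} \<Rightarrow> 'h) \<Rightarrow> ('d obs \<Rightarrow> 'h \<Rightarrow> 'h) \<Rightarrow> 'h \<Rightarrow> bool" where
  "kolmogorov J rep z \<longleftrightarrow>
     (\<forall>v. ((\<lambda>n. E_proj J rep z n v) \<longlongrightarrow> cscale J (cinner J z v) z) at_bot)"

end

theory Submission
  imports Defs
begin

text \<open>
  In the GNS space of either state let \<open>K n\<close> be the closure of the vectors \<open>\<pi>(x)\<zeta>\<close> with \<open>x\<close> local and
  supported on the sites \<open>\<le> n\<close>. These closed subspaces increase with \<open>n\<close>, have dense union, and the
  shift unitary \<open>S\<close> maps \<open>K n\<close> onto \<open>K (n + 1)\<close>. Their intersection is \<open>\<complex>\<zeta>\<close>: for \<open>\<omega>\<close> because \<open>K n\<close> lies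
  in the range of \<open>E\<^sub>n\<close>, for the product state because it factorizes over disjoint regions. Hence
  \<open>S\<close> is the identity on \<open>\<complex>\<zeta>\<close> plus a bilateral shift whose multiplicity is the dimension of
  \<open>W = K 1 \<ominus> K 0\<close>. The space \<open>W\<close> is separable, is nonzero since \<open>d \<ge> 2\<close>, and is invariant under the
  infinitely many commuting matrix algebras of the sites \<open>\<le> 0\<close>, so its dimension is countably
  infinite in both cases, and two bilateral shifts of equal multiplicity are unitarily equivalent.
\<close>

section \<open>Closed subspaces of Hilbert spaces\<close>

text \<open>The unitary need not intertwine the two representations, so only the spectral type of
  the shift has to be compared. The subspaces \<open>K n\<close> replace the ranges of
  \<open>E_proj\<close> because they have the same description for both states and the local algebra
  visibly acts on them. Only the inclusion of \<open>K n\<close> in the range of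
  \<open>E_proj J rep z n\<close> is needed: a vector in every \<open>K n\<close> is fixed by every
  projection, and strong convergence evaluates the resulting constant family. The multiplicity is
  never computed as an exact dimension. Separability makes an orthonormal basis of \<open>W\<close>
  countable, and \<open>d ^ n\<close> orthogonal vectors for every \<open>n\<close> make it
  infinite, so both bases can be indexed by \<open>nat\<close> and matched index by index. If
  \<open>W\<close> were zero, all \<open>K n\<close> would coincide and, being closed with dense
  union, fill the space; trivial intersection would then make the space one-dimensional, which a
  full matrix algebra with \<open>d \<ge> 2\<close> excludes. Complex Hilbert spaces are real ones
  with a complex structure \<open>J\<close>. Spans, orthogonality and dimension are therefore real
  notions, and images under \<open>J\<close> have to be carried along throughout.\<close>

lemma Cauchy_minimizing_sequence:
  fixes K :: "'h::real_inner set"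
  assumes K: "subspace K" and y: "\<And>n. y n \<in> K"
    and ge: "\<And>u. u \<in> K \<Longrightarrow> (norm (x - u))\<^sup>2 \<ge> d"
    and le: "\<And>n. (norm (x - y n))\<^sup>2 \<le> d + inverse (real (Suc n))"
  shows "Cauchy y"
proof (rule metric_CauchyI)
  \<comment> \<open>Parallelogram law: the midpoint of two near-minimizers lies in \<open>K\<close>,
    so it cannot be closer to \<open>x\<close> than the bound \<open>d\<close> on squared distances
    permits.\<close>
  have par: "(norm (y n - y m))\<^sup>2 \<le> 2 * inverse (real (Suc n)) + 2 * inverse (real (Suc m))" for n m
  proof -
    have "(1/2) *\<^sub>R (y n + y m) \<in> K"
      using K y by (meson subspace_add subspace_scale)
    from ge[OF this] have "d \<le> (norm (x - (1/2) *\<^sub>R (y n + y m)))\<^sup>2" .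
    moreover have "(norm (y n - y m))\<^sup>2 = 2 * (norm (x - y n))\<^sup>2 + 2 * (norm (x - y m))\<^sup>2
        - 4 * (norm (x - (1/2) *\<^sub>R (y n + y m)))\<^sup>2"
      by (simp add: power2_norm_eq_inner algebra_simps inner_commute)
    ultimately show ?thesis using le[of n] le[of m] by linarith
  qed
  fix e :: real assume "e > 0"
  \<comment> \<open>With this threshold each of the two terms in \<open>par\<close> is below half of
    the square of \<open>e\<close>.\<close>
  then obtain N where N: "inverse (real (Suc N)) < e\<^sup>2 / 4"
    using reals_Archimedean[of "e\<^sup>2 / 4"] by auto
  have "dist (y m) (y n) < e" if "m \<ge> N" "n \<ge> N" for m n
  proof -
    have *: "inverse (real (Suc k)) \<le> inverse (real (Suc N))" if "k \<ge> N" for k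
      using that by (simp add: field_simps)
    have "(norm (y m - y n))\<^sup>2 < e\<^sup>2"
      using par[of m n] *[OF that(1)] *[OF that(2)] N by linarith
    with \<open>e > 0\<close> show ?thesis by (simp add: dist_norm power2_less_imp_less)
  qed
  then show "\<exists>M. \<forall>m\<ge>M. \<forall>n\<ge>M. dist (y m) (y n) < e" by blast
qed

lemma norm_diff_scale:
  fixes r u :: "'h::real_inner"
  shows "(norm (r - t *\<^sub>R u))\<^sup>2 = (norm r)\<^sup>2 - 2 * t * inner r u + t\<^sup>2 * inner u u"
  unfolding power2_norm_eq_inner by (simp add: inner_diff_left inner_diff_right inner_commute[of u r] power2_eq_square algebra_simps)

text \<open>The projection theorem: a minimizing sequence converges by completeness, and its limit
  \<open>p\<close> is orthogonal to \<open>K\<close> in the residual because moving \<open>p\<close>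
  along \<open>u\<close> cannot decrease the distance.\<close>

lemma closed_subspace_projection:
  fixes K :: "'h::{real_inner,complete_space} set"
  assumes K: "subspace K" and cl: "closed K"
  obtains p where "p \<in> K" "\<And>u. u \<in> K \<Longrightarrow> inner (x - p) u = 0"
proof -
  define A where "A = (\<lambda>u. (norm (x - u))\<^sup>2) ` K"
  have A: "A \<noteq> {}" "bdd_below A"
    using subspace_0[OF K] by (auto simp: A_def intro!: bdd_belowI2[where m=0])
  have ge: "(norm (x - u))\<^sup>2 \<ge> Inf A" if "u \<in> K" for u
    using A(2) that by (auto simp: A_def intro: cInf_lower)
  have "\<exists>u\<in>K. (norm (x - u))\<^sup>2 \<le> Inf A + inverse (real (Suc n))" for n
    using cInf_lessD[OF A(1), of "Inf A + inverse (real (Suc n))"] 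
    by (force simp: A_def less_imp_le)
  then obtain y where y: "\<And>n. y n \<in> K" "\<And>n. (norm (x - y n))\<^sup>2 \<le> Inf A + inverse (real (Suc n))"
    by metis
  obtain p where p: "y \<longlonglongrightarrow> p"
    using Cauchy_convergent[OF Cauchy_minimizing_sequence[OF K y(1) ge y(2)]] 
    by (auto simp: convergent_def)
  have pK: "p \<in> K" using closed_sequentially[OF cl] y(1) p by blast
  have "(\<lambda>n. (norm (x - y n))\<^sup>2) \<longlonglongrightarrow> (norm (x - p))\<^sup>2"
    by (intro tendsto_intros p)
  moreover have "(\<lambda>n. Inf A + inverse (real (Suc n))) \<longlonglongrightarrow> Inf A + 0"
    by (intro tendsto_intros LIMSEQ_inverse_real_of_nat)
  ultimately have le: "(norm (x - p))\<^sup>2 \<le> Inf A"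
    using y(2) by (metis (no_types, lifting) LIMSEQ_le add_0_right)
  have "inner (x - p) u = 0" if u: "u \<in> K" for u
  proof (cases "u = 0")
    case False
    \<comment> \<open>This \<open>t\<close> minimizes the quadratic polynomial of
      \<open>norm_diff_scale\<close>.\<close>
    define t where "t = inner (x - p) u / inner u u"
    have "p + t *\<^sub>R u \<in> K" using K pK u by (simp add: subspace_add subspace_scale)
    from ge[OF this] le have "(norm (x - p))\<^sup>2 \<le> (norm (x - (p + t *\<^sub>R u)))\<^sup>2"
      by linarith
    also have "x - (p + t *\<^sub>R u) = (x - p) - t *\<^sub>R u" by simp
    also have "(norm \<dots>)\<^sup>2 = (norm (x - p))\<^sup>2 - 2 * t * inner (x - p) u + t\<^sup>2 * inner u u"
      by (rule norm_diff_scale)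
    also have "\<dots> = (norm (x - p))\<^sup>2 - (inner (x - p) u)\<^sup>2 / inner u u"
      using False by (simp add: t_def power2_eq_square)
    finally have "(inner (x - p) u)\<^sup>2 / inner u u \<le> 0" by simp
    moreover have "inner u u > 0" using False by simp
    ultimately show ?thesis by (simp add: divide_le_0_iff)
  qed simp
  with pK that show ?thesis by blast
qed

lemma subspace_closure:
  fixes K :: "'h::real_normed_vector set"
  assumes "subspace K"
  shows "subspace (closure K)"
  unfolding subspace_def
proof (intro conjI ballI allI)
  show "0 \<in> closure K" using subspace_0[OF assms] closure_subset by blast
  fix x y assume "x \<in> closure K" "y \<in> closure K"
  then obtain f g where "\<And>n. f n \<in> K" "f \<longlonglongrightarrow> x" "\<And>n. g n \<in> K" "g \<longlonglongrightarrow> y"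
    unfolding closure_sequential by blast
  then show "x + y \<in> closure K" unfolding closure_sequential
    by (intro exI[of _ "\<lambda>n. f n + g n"]) (auto intro: tendsto_intros subspace_add[OF assms])
next
  fix c x assume "x \<in> closure K"
  then obtain f where "\<And>n. f n \<in> K" "f \<longlonglongrightarrow> x"
    unfolding closure_sequential by blast
  then show "c *\<^sub>R x \<in> closure K" unfolding closure_sequential
    by (intro exI[of _ "\<lambda>n. c *\<^sub>R f n"]) (auto intro: tendsto_intros subspace_scale[OF assms])
qed

lemma orthogonal_closure:
  fixes x :: "'h::real_inner"
  assumes "\<And>u. u \<in> D \<Longrightarrow> inner x u = 0" and "y \<in> closure D"
  shows "inner x y = 0"
proof -
  have "closed {y. inner x y = 0}"
    by (intro closed_Collect_eq continuous_intros)
  moreover have "D \<subseteq> {y. inner x y = 0}" using assms(1) by auto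
  ultimately show ?thesis using assms(2) closure_minimal by blast
qed

lemma orthogonal_span:
  assumes "\<And>u. u \<in> D \<Longrightarrow> inner x u = 0" and "y \<in> span D"
  shows "inner x y = 0"
  using assms(2) by (induction rule: span_induct_alt) (auto simp: inner_add_right assms(1))

text \<open>The residual of the projection onto the closed span is orthogonal to \<open>D\<close>,
  hence zero.\<close>

lemma dense_span_if_total:
  fixes D :: "'h::{real_inner,complete_space} set"
  assumes "\<And>x. (\<And>u. u \<in> D \<Longrightarrow> inner x u = 0) \<Longrightarrow> x = 0"
  shows "closure (span D) = UNIV"
proof -
  have "x \<in> closure (span D)" for x
  proof -
    obtain p where p: "p \<in> closure (span D)" "\<And>u. u \<in> closure (span D) \<Longrightarrow> inner (x - p) u = 0"
      using closed_subspace_projection[OF subspace_closure[OF subspace_span] closed_closure] by blast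
    have "x - p = 0"
      by (rule assms) (use p(2) closure_subset span_superset in blast)
    with p(1) show ?thesis by simp
  qed
  then show ?thesis by blast
qed

lemma bounded_linear_eq_on_dense_span:
  fixes f g :: "'a::real_normed_vector \<Rightarrow> 'b::real_normed_vector"
  assumes "bounded_linear f" "bounded_linear g" "closure (span D) = UNIV" "\<And>x. x \<in> D \<Longrightarrow> f x = g x"
  shows "f = g"
proof -
  have "closed {x. f x = g x}"
    using assms(1,2) by (intro closed_Collect_eq linear_continuous_on)
  moreover have "span D \<subseteq> {x. f x = g x}"
    using assms by (auto intro: linear_eq_on_span bounded_linear.linear)
  ultimately have "closure (span D) \<subseteq> {x. f x = g x}" by (rule closure_minimal[rotated])
  with assms(3) show ?thesis by auto
qed

section \<open>Unitaries from inner-product preserving correspondences\<close>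

lemma inner_eq_on_span:
  fixes B :: "('a::real_inner \<times> 'b::real_inner) set"
  assumes "\<And>x y x' y'. (x, y) \<in> B \<Longrightarrow> (x', y') \<in> B \<Longrightarrow> inner x x' = inner y y'"
    and "p \<in> span B" "q \<in> span B"
  shows "inner (fst p) (fst q) = inner (snd p) (snd q)"
proof -
  have *: "inner (fst p) (fst q) = inner (snd p) (snd q)" if "p \<in> B" "q \<in> span B" for p q
    using that(2)
    by (induction rule: span_induct_alt) (use that(1) assms(1) in \<open>auto simp: inner_add_right\<close>)
  show ?thesis
    using assms(2)
    by (induction rule: span_induct_alt) (use * assms(3) in \<open>auto simp: inner_add_left\<close>)
qed

text \<open>Extension by continuity for a linear relation: the norm identity turns convergence of
  first components into the Cauchy property of second components.\<close>

lemma fst_closure_graph: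
  fixes G :: "('a::{real_inner,complete_space} \<times> 'b::{real_inner,complete_space}) set"
  assumes G: "subspace G" and iso: "\<And>p. p \<in> G \<Longrightarrow> norm (fst p) = norm (snd p)"
    and dense: "closure (fst ` G) = UNIV"
  shows "\<exists>y. (x, y) \<in> closure G"
proof -
  have "x \<in> closure (fst ` G)" using dense by simp
  then obtain a where a: "\<And>n. a n \<in> fst ` G" "a \<longlonglongrightarrow> x"
    unfolding closure_sequential by blast
  have "\<forall>n. \<exists>c. (a n, c) \<in> G" using a(1) by (metis imageE prod.collapse)
  then obtain b where b: "\<And>n. (a n, b n) \<in> G" by metis
  have "dist (b m) (b n) = dist (a m) (a n)" for m n
    using iso[OF subspace_diff[OF G b[of m] b[of n]]] by (simp add: dist_norm)
  moreover have "Cauchy a" using a(2) LIMSEQ_imp_Cauchy by blast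
  ultimately have "Cauchy b" by (simp add: Cauchy_def)
  then obtain y where "b \<longlonglongrightarrow> y" using Cauchy_convergent convergent_def by blast
  with a(2) have "(\<lambda>n. (a n, b n)) \<longlonglongrightarrow> (x, y)" by (rule tendsto_Pair)
  with b show ?thesis unfolding closure_sequential by fast
qed

text \<open>The unitary is obtained as a closed linear relation, the closure of the real span of
  \<open>B\<close> in the product space. Working with relations avoids checking that a linear
  extension of the assignment is well defined; this follows from the norm identity
  afterwards.\<close>

lemma unitary_from_correspondence:
  fixes B :: "('a::{real_inner,complete_space} \<times> 'b::{real_inner,complete_space}) set"
  assumes inn: "\<And>x y x' y'. (x, y) \<in> B \<Longrightarrow> (x', y') \<in> B \<Longrightarrow> inner x x' = inner y y'"
    and d1: "closure (span (fst ` B)) = UNIV" and d2: "closure (span (snd ` B)) = UNIV"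
  obtains U where "bounded_linear U" "bij U" "\<forall>x. norm (U x) = norm x" "\<forall>(x, y)\<in>B. U x = y"
proof -
  let ?G = "closure (span B)"
  have iso0: "norm (fst p) = norm (snd p)" if "p \<in> span B" for p
    using inner_eq_on_span[OF inn that that] by (simp add: norm_eq_sqrt_inner)
  have sub: "subspace ?G" by (rule subspace_closure[OF subspace_span])
  have iso: "norm (fst p) = norm (snd p)" if "p \<in> ?G" for p
  proof -
    have "closed {p :: 'a \<times> 'b. norm (fst p) = norm (snd p)}"
      by (intro closed_Collect_eq continuous_intros)
    moreover have "span B \<subseteq> {p. norm (fst p) = norm (snd p)}" using iso0 by blast
    ultimately show ?thesis using that closure_minimal by blast
  qed
  have ex1: "\<exists>y. (x, y) \<in> ?G" for x
    using fst_closure_graph[OF subspace_span iso0] d1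
    by (simp add: linear_span_image[OF linear_fst])
  have swp: "linear (prod.swap :: 'a \<times> 'b \<Rightarrow> 'b \<times> 'a)"
    by (rule linearI) auto
  \<comment> \<open>Surjectivity is the existence statement for the converse relation.\<close>
  have ex2: "\<exists>x. (x, y) \<in> ?G" for y
  proof -
    have "\<exists>x. (y, x) \<in> closure (span (prod.swap ` B))"
    proof (rule fst_closure_graph[OF subspace_span])
      show "norm (fst p) = norm (snd p)" if "p \<in> span (prod.swap ` B)" for p
        using that iso0 by (auto simp: linear_span_image[OF swp])
      show "closure (fst ` span (prod.swap ` B)) = UNIV"
        using d2 by (simp add: linear_span_image[OF swp] linear_span_image[OF linear_snd] image_image)
    qed
    then obtain x where "(y, x) \<in> closure (prod.swap ` span B)"
      by (auto simp: linear_span_image[OF swp])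
    then obtain f where f: "\<And>n. f n \<in> prod.swap ` span B" "f \<longlonglongrightarrow> (y, x)"
      unfolding closure_sequential by blast
    then have "\<And>n. prod.swap (f n) \<in> span B" by (metis imageE swap_swap)
    moreover have "(\<lambda>n. prod.swap (f n)) \<longlonglongrightarrow> (x, y)"
      unfolding prod.swap_def using tendsto_Pair[OF tendsto_snd[OF f(2)] tendsto_fst[OF f(2)]] by simp
    ultimately show ?thesis unfolding closure_sequential by fast
  qed
  \<comment> \<open>The difference of the two pairs is \<open>(0, y - y')\<close>, and the norm
    identity makes its second component vanish.\<close>
  have uni: "y = y'" if "(x, y) \<in> ?G" "(x, y') \<in> ?G" for x y y'
    using iso[OF subspace_diff[OF sub that]] by simp
  obtain U where U: "\<And>x. (x, U x) \<in> ?G" using ex1 by metis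
  have Ueq: "U x = y" if "(x, y) \<in> ?G" for x y using uni[OF U that] .
  have nrm: "norm (U x) = norm x" for x using iso[OF U[of x]] by simp
  have "bounded_linear U"
  proof (rule bounded_linear_intro[where K=1])
    show "U (x + y) = U x + U y" for x y
      using subspace_add[OF sub U[of x] U[of y]] by (simp add: Ueq)
    show "U (r *\<^sub>R x) = r *\<^sub>R U x" for r x
      using subspace_scale[OF sub U[of x]] by (simp add: Ueq)
  qed (simp add: nrm)
  moreover have "bij U"
  proof (rule bijI)
    show "inj U"
      using nrm bounded_linear.linear[OF \<open>bounded_linear U\<close>]
      by (metis linear_injective_0 norm_eq_zero)
    show "surj U" using ex2 Ueq by (metis surjI)
  qed
  moreover have "U x = y" if "(x, y) \<in> B" for x y
    using that Ueq span_superset closure_subset by (metis subset_iff)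
  ultimately show ?thesis using that nrm by blast
qed

section \<open>Complex orthonormal bases\<close>

lemma cplx_structD:
  assumes "cplx_struct J"
  shows "linear J" "J (J x) = - x" "inner (J x) (J y) = inner x y" "inner (J x) y = - inner x (J y)"
    "inner x (J x) = 0" "norm (J x) = norm x" "bounded_linear J"
proof -
  show lin: "linear J" and JJ: "J (J x) = - x" and iso: "\<And>x y. inner (J x) (J y) = inner x y"
    using assms by (auto simp: cplx_struct_def)
  show skew: "inner (J x) y = - inner x (J y)" for x y
    using assms iso[of x "J y"] by (simp add: cplx_struct_def)
  show "inner x (J x) = 0" using skew[of x x] by (simp add: inner_commute)
  show nrm: "norm (J x) = norm x" for x using iso by (simp add: norm_eq_sqrt_inner)
  show "bounded_linear J"
    by (rule bounded_linear_intro[where K=1]) (auto simp: linear_add[OF lin] linear_scale[OF lin] nrm)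
qed

lemma bessel_inequality:
  fixes F :: "'h::real_inner set"
  assumes "finite F" and on: "\<And>b c. b \<in> F \<Longrightarrow> c \<in> F \<Longrightarrow> inner b c = (if b = c then 1 else 0)"
  shows "(\<Sum>b\<in>F. (inner g b)\<^sup>2) \<le> (norm g)\<^sup>2"
proof -
  define p where "p = (\<Sum>b\<in>F. inner g b *\<^sub>R b)"
  have gp: "inner g p = (\<Sum>b\<in>F. (inner g b)\<^sup>2)"
    by (simp add: p_def inner_sum_right power2_eq_square)
  have "inner p c = inner g c" if "c \<in> F" for c
  proof -
    have "inner p c = (\<Sum>b\<in>F. if b = c then inner g b else 0)"
      unfolding p_def inner_sum_left by (intro sum.cong) (auto simp: on that)
    then show ?thesis using that assms(1) by simp
  qed
  then have pp: "inner p p = (\<Sum>b\<in>F. (inner g b)\<^sup>2)"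
    by (subst (2) p_def) (simp add: inner_sum_right power2_eq_square)
  have "0 \<le> inner (g - p) (g - p)" by simp
  also have "\<dots> = inner g g - inner g p"
    using gp pp by (simp add: inner_diff_left inner_diff_right inner_commute[of p g])
  finally show ?thesis using gp by (simp add: power2_norm_eq_inner)
qed

text \<open>By Bessel, a fixed \<open>g\<close> has only finitely many coefficients of square above
  \<open>1 / (n + 1)\<close>. Each \<open>b\<close> has a nonzero coefficient with some
  \<open>g\<close> in \<open>G\<close>, since otherwise it would be orthogonal to a dense
  subspace.\<close>

lemma countable_orthonormal:
  fixes B G :: "'h::real_inner set"
  assumes on: "\<And>b c. b \<in> B \<Longrightarrow> c \<in> B \<Longrightarrow> inner b c = (if b = c then 1 else 0)"
    and G: "countable G" "closure (span G) = UNIV"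
  shows "countable B"
proof -
  have fin: "finite {b \<in> B. (inner g b)\<^sup>2 > inverse (real (Suc n))}" for g n
  proof -
    have "card F \<le> nat \<lceil>(norm g)\<^sup>2 * real (Suc n)\<rceil>"
      if F: "F \<subseteq> {b \<in> B. (inner g b)\<^sup>2 > inverse (real (Suc n))}" "finite F" for F
    proof -
      have "real (card F) * inverse (real (Suc n)) = (\<Sum>b\<in>F. inverse (real (Suc n)))" by simp
      also have "\<dots> \<le> (\<Sum>b\<in>F. (inner g b)\<^sup>2)"
        by (intro sum_mono) (use F(1) in \<open>auto simp: less_imp_le\<close>)
      also have "\<dots> \<le> (norm g)\<^sup>2"
        by (intro bessel_inequality F(2) on) (use F(1) in auto)
      finally have "real (card F) \<le> (norm g)\<^sup>2 * real (Suc n)" by (simp add: field_simps)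
      then show ?thesis by linarith
    qed
    then show ?thesis using finite_if_finite_subsets_card_bdd by blast
  qed
  have "B \<subseteq> (\<Union>g\<in>G. \<Union>n. {b \<in> B. (inner g b)\<^sup>2 > inverse (real (Suc n))})"
  proof
    fix b assume b: "b \<in> B"
    have "\<exists>g\<in>G. inner g b \<noteq> 0"
    proof (rule ccontr)
      assume "\<not> ?thesis"
      then have "inner b u = 0" if "u \<in> span G" for u
        using that orthogonal_span[of G b u] by (metis inner_commute)
      then have "inner b b = 0" using orthogonal_closure[of "span G" b b] G(2) by blast
      with on[OF b b] show False by simp
    qed
    then obtain g where g: "g \<in> G" "(inner g b)\<^sup>2 > 0" by auto
    then show "b \<in> (\<Union>g\<in>G. \<Union>n. {b \<in> B. (inner g b)\<^sup>2 > inverse (real (Suc n))})"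
      using reals_Archimedean[OF g(2)] b by blast
  qed
  moreover have "countable (\<Union>g\<in>G. \<Union>n. {b \<in> B. (inner g b)\<^sup>2 > inverse (real (Suc n))})"
    using G(1) fin by (intro countable_UN) (auto intro: countable_finite)
  ultimately show ?thesis using countable_subset by blast
qed

text \<open>The two conditions are the real and imaginary parts of orthonormality for
  \<open>cinner J\<close>.\<close>

definition complex_orthonormal :: "('h::real_inner \<Rightarrow> 'h) \<Rightarrow> ('i \<Rightarrow> 'h) \<Rightarrow> bool" where
  "complex_orthonormal J b \<longleftrightarrow>
     (\<forall>i j. inner (b i) (b j) = (if i = j then 1 else 0)) \<and> (\<forall>i j. inner (b i) (J (b j)) = 0)"

lemma span_orthonormal_finite:
  fixes R :: "'h::real_inner set"
  assumes "finite R" and on: "\<And>b c. b \<in> R \<Longrightarrow> c \<in> R \<Longrightarrow> inner b c = (if b = c then 1 else 0)"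
  obtains p where "p \<in> span R" "\<And>c. c \<in> R \<Longrightarrow> inner (x - p) c = 0"
proof
  define p where "p = (\<Sum>b\<in>R. inner x b *\<^sub>R b)"
  show "p \<in> span R" unfolding p_def by (intro span_sum span_scale span_base)
  show "inner (x - p) c = 0" if "c \<in> R" for c
  proof -
    have "inner p c = (\<Sum>b\<in>R. if b = c then inner x b else 0)"
      unfolding p_def inner_sum_left by (intro sum.cong) (auto simp: on that)
    then show ?thesis using that assms(1) by (simp add: inner_diff_left)
  qed
qed

text \<open>Zorn's lemma: a nonzero vector of \<open>W\<close> orthogonal to \<open>B\<close> and to
  its image under \<open>J\<close> could be normalized and adjoined, since \<open>y\<close> is
  always orthogonal to \<open>J y\<close>.\<close>

lemma maximal_complex_orthonormal_set:
  fixes W :: "'h::real_inner set"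
  assumes J: "cplx_struct J" and W: "subspace W"
  obtains B where "B \<subseteq> W" "\<forall>b\<in>B. \<forall>c\<in>B. inner b c = (if b = c then 1 else 0)"
    "\<forall>b\<in>B. \<forall>c\<in>B. inner b (J c) = 0"
    "\<forall>x\<in>W. (\<forall>b\<in>B. inner x b = 0 \<and> inner x (J b) = 0) \<longrightarrow> x = 0"
proof -
  define P where "P B \<longleftrightarrow> B \<subseteq> W \<and>
    (\<forall>b\<in>B. \<forall>c\<in>B. inner b c = (if b = c then 1 else 0) \<and> inner b (J c) = 0)" for B
  have "\<exists>M\<in>Collect P. \<forall>X\<in>Collect P. M \<subseteq> X \<longrightarrow> X = M"
  proof (rule subset_Zorn')
    fix C assume C: "subset.chain (Collect P) C"
    then have CP: "P X" if "X \<in> C" for X using that by (auto simp: subset.chain_def)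
    show "\<Union>C \<in> Collect P"
      unfolding mem_Collect_eq P_def
    proof (intro conjI ballI)
      show "\<Union>C \<subseteq> W" using CP by (auto simp: P_def)
      fix b c assume "b \<in> \<Union>C" "c \<in> \<Union>C"
      then obtain X Y where XY: "X \<in> C" "Y \<in> C" "b \<in> X" "c \<in> Y" by blast
      have "X \<subseteq> Y \<or> Y \<subseteq> X" using C XY(1,2) unfolding subset.chain_def by blast
      then obtain X where X: "X \<in> C" "b \<in> X" "c \<in> X" using XY by blast
      with CP[OF X(1)] show "inner b c = (if b = c then 1 else 0)" "inner b (J c) = 0"
        by (auto simp: P_def)
    qed
  qed
  then obtain B where PB: "P B" and max: "\<And>X. P X \<Longrightarrow> B \<subseteq> X \<Longrightarrow> X = B" by auto
  have tot: "x = 0" if x: "x \<in> W" "\<And>b. b \<in> B \<Longrightarrow> inner x b = 0 \<and> inner x (J b) = 0" for x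
  proof (rule ccontr)
    assume x0: "x \<noteq> 0"
    define y where "y = (1 / norm x) *\<^sub>R x"
    have yW: "y \<in> W" using x(1) W by (simp add: y_def subspace_scale)
    have yy: "inner y y = 1"
      using x0 by (simp add: y_def power2_norm_eq_inner[symmetric] power2_eq_square)
    have yb: "inner y b = 0" "inner y (J b) = 0" "inner b (J y) = 0" "inner b y = 0" if "b \<in> B" for b
      using x(2)[OF that] cplx_structD(4)[OF J, of b x]
      by (auto simp: y_def linear_scale[OF cplx_structD(1)[OF J]] inner_commute)
    have "P (insert y B)"
      using PB yW yy yb cplx_structD(5)[OF J, of y] by (auto simp: P_def)
    then have "y \<in> B" using max by blast
    with yb(1) yy show False by force
  qed
  show ?thesis
  proof (rule that)
    show "B \<subseteq> W" using PB by (simp add: P_def)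
    show "\<forall>b\<in>B. \<forall>c\<in>B. inner b c = (if b = c then 1 else 0)" "\<forall>b\<in>B. \<forall>c\<in>B. inner b (J c) = 0"
      using PB by (auto simp: P_def)
  qed (use tot in blast)
qed

text \<open>Both bounds on the dimension are turned into an enumeration by \<open>nat\<close>, so
  that the bases of two such spaces have the same index set.\<close>

lemma complex_orthonormal_basis_nat:
  fixes W G :: "'h::real_inner set"
  assumes J: "cplx_struct J" and W: "subspace W" "\<And>x. x \<in> W \<Longrightarrow> J x \<in> W"
    and G: "countable G" "closure (span G) = UNIV"
    and inf: "\<And>n. \<exists>A\<subseteq>W. finite A \<and> card A > n \<and> pairwise orthogonal A \<and> 0 \<notin> A"
  obtains b :: "nat \<Rightarrow> 'h" where "range b \<subseteq> W" "complex_orthonormal J b"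
    "\<forall>x\<in>W. (\<forall>i. inner x (b i) = 0 \<and> inner x (J (b i)) = 0) \<longrightarrow> x = 0"
proof -
  obtain B where "B \<subseteq> W" "\<forall>b\<in>B. \<forall>c\<in>B. inner b c = (if b = c then 1 else 0)"
    "\<forall>b\<in>B. \<forall>c\<in>B. inner b (J c) = 0"
    "\<forall>x\<in>W. (\<forall>b\<in>B. inner x b = 0 \<and> inner x (J b) = 0) \<longrightarrow> x = 0"
    using maximal_complex_orthonormal_set[OF J W(1)] by blast
  note B = this(1) this(2,3)[rule_format] this(4)
  have "countable B" using countable_orthonormal[OF B(2) G] by blast
  moreover have "infinite B"
  proof
    assume fin: "finite B"
    \<comment> \<open>If \<open>B\<close> were finite, \<open>?R\<close> would be a finite real
      orthonormal set spanning \<open>W\<close>, which bounds the size of every independent subset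
      of \<open>W\<close>.\<close>
    let ?R = "B \<union> J ` B"
    have "inner b c = (if b = c then 1 else 0)" if "b \<in> ?R" "c \<in> ?R" for b c
    proof -
      have "inner u (J v) = (if u = J v then 1 else 0)" if "u \<in> B" "v \<in> B" for u v
        using B(2)[OF that(1) that(1)] B(3)[OF that] by auto
      moreover have "inner (J u) (J v) = (if J u = J v then 1 else 0)" if "u \<in> B" "v \<in> B" for u v
      proof -
        have "J u = J v \<longleftrightarrow> u = v" using cplx_structD(2)[OF J] by (metis neg_equal_iff_equal)
        then show ?thesis using B(2)[OF that] cplx_structD(3)[OF J] by simp
      qed
      ultimately show ?thesis using that B(2) by (auto simp: inner_commute)
    qed
    note on = this
    have Wspan: "W \<subseteq> span ?R"
    proof
      fix x assume x: "x \<in> W"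
      obtain p where p: "p \<in> span ?R" "\<And>c. c \<in> ?R \<Longrightarrow> inner (x - p) c = 0"
        using span_orthonormal_finite[of ?R x] on fin by (metis finite_Un finite_imageI)
      have "span ?R \<subseteq> W" using B(1) W by (intro span_minimal) auto
      then have "x - p \<in> W" using x p(1) W(1) by (meson subsetD subspace_diff)
      then have "x - p = 0" using p(2) B(4) by blast
      with p(1) show "x \<in> span ?R" by simp
    qed
    obtain A where A: "A \<subseteq> W" "finite A" "card A > card ?R" "pairwise orthogonal A" "0 \<notin> A"
      using inf by metis
    then have "card A \<le> card ?R"
      using independent_span_bound[of ?R A] pairwise_orthogonal_independent fin Wspan by auto
    with A(3) show False by simp
  qed
  ultimately have bij: "bij_betw (from_nat_into B) UNIV B" by (rule bij_betw_from_nat_into)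
  let ?b = "from_nat_into B"
  have bB: "?b i \<in> B" for i using bij by (auto simp: bij_betw_def)
  have inj: "?b i = ?b j \<longleftrightarrow> i = j" for i j using bij by (auto simp: bij_betw_def inj_on_def)
  show ?thesis
  proof (rule that[of ?b])
    show "range ?b \<subseteq> W" using bB B(1) by auto
    show "complex_orthonormal J ?b"
      using B(2,3) bB inj by (auto simp: complex_orthonormal_def)
    have "\<exists>i. b = ?b i" if "b \<in> B" for b using bij that by (auto simp: bij_betw_def)
    then show "\<forall>x\<in>W. (\<forall>i. inner x (?b i) = 0 \<and> inner x (J (?b i)) = 0) \<longrightarrow> x = 0"
      using B(4) by metis
  qed
qed

section \<open>Bilateral shifts\<close>

text \<open>\<open>None\<close> indexes the fixed vector and \<open>Some (k, n)\<close> the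
  \<open>n\<close>-th wandering vector moved \<open>k\<close> steps. The second conjunct says that
  the complex span is dense.\<close>

definition bilateral_shift_basis ::
  "('h::real_inner \<Rightarrow> 'h) \<Rightarrow> ('h \<Rightarrow> 'h) \<Rightarrow> 'h \<Rightarrow> (int \<times> nat \<Rightarrow> 'h) \<Rightarrow> bool" where
  "bilateral_shift_basis J S z e \<longleftrightarrow>
     complex_orthonormal J (case_option z e) \<and>
     (\<forall>x. (\<forall>i. inner x (case_option z e i) = 0 \<and> inner x (J (case_option z e i)) = 0) \<longrightarrow> x = 0) \<and>
     S z = z \<and> (\<forall>k n. S (e (k, n)) = e (k + 1, n))"

text \<open>Basis vectors with equal index are matched. The relation \<open>B\<close> also contains
  the pairs of \<open>J\<close>-images, because the span is only real and the matching must commute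
  with the complex structures.\<close>

lemma bilateral_shifts_unitarily_equivalent:
  fixes J1 S1 :: "'h1::{real_inner,complete_space} \<Rightarrow> 'h1" and J2 S2 :: "'h2::{real_inner,complete_space} \<Rightarrow> 'h2"
  assumes J1: "cplx_struct J1" and S1: "bcl J1 S1" and e1: "bilateral_shift_basis J1 S1 z1 e1"
    and J2: "cplx_struct J2" and S2: "bcl J2 S2" and e2: "bilateral_shift_basis J2 S2 z2 e2"
  shows "\<exists>U. unitary_map J1 J2 U \<and> U z1 = z2 \<and> U \<circ> S1 = S2 \<circ> U"
proof -
  define f1 where "f1 = case_option z1 e1"
  define f2 where "f2 = case_option z2 e2"
  have on1: "inner (f1 i) (f1 j) = (if i = j then 1 else 0)" "inner (f1 i) (J1 (f1 j)) = 0" for i j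
    using e1 by (auto simp: bilateral_shift_basis_def complex_orthonormal_def f1_def)
  have on2: "inner (f2 i) (f2 j) = (if i = j then 1 else 0)" "inner (f2 i) (J2 (f2 j)) = 0" for i j
    using e2 by (auto simp: bilateral_shift_basis_def complex_orthonormal_def f2_def)
  define B where "B = range (\<lambda>i. (f1 i, f2 i)) \<union> range (\<lambda>i. (J1 (f1 i), J2 (f2 i)))"
  define D where "D = range f1 \<union> range (\<lambda>i. J1 (f1 i))"
  have fB: "fst ` B = D" "snd ` B = range f2 \<union> range (\<lambda>i. J2 (f2 i))"
    by (auto simp: B_def D_def image_Un image_image)
  have d1: "closure (span D) = UNIV"
  proof (rule dense_span_if_total)
    fix x assume x: "\<And>u. u \<in> D \<Longrightarrow> inner x u = 0"
    have "inner x (f1 i) = 0 \<and> inner x (J1 (f1 i)) = 0" for i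
      using x[of "f1 i"] x[of "J1 (f1 i)"] by (auto simp: D_def)
    then show "x = 0" using e1 by (simp add: bilateral_shift_basis_def f1_def)
  qed
  have d2: "closure (span (range f2 \<union> range (\<lambda>i. J2 (f2 i)))) = UNIV"
  proof (rule dense_span_if_total)
    fix x assume x: "\<And>u. u \<in> range f2 \<union> range (\<lambda>i. J2 (f2 i)) \<Longrightarrow> inner x u = 0"
    have "inner x (f2 i) = 0 \<and> inner x (J2 (f2 i)) = 0" for i
      using x[of "f2 i"] x[of "J2 (f2 i)"] by auto
    then show "x = 0" using e2 by (simp add: bilateral_shift_basis_def f2_def)
  qed
  have inn: "inner x x' = inner y y'" if "(x, y) \<in> B" "(x', y') \<in> B" for x y x' y'
    using that by (auto simp: B_def on1 on2 cplx_structD(2,4)[OF J1] cplx_structD(2,4)[OF J2])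
  have d: "closure (span (fst ` B)) = UNIV" "closure (span (snd ` B)) = UNIV"
    using d1 d2 by (simp_all only: fB)
  obtain U where U: "bounded_linear U" "bij U" "\<forall>x. norm (U x) = norm x" "\<forall>(x, y)\<in>B. U x = y"
    by (rule unitary_from_correspondence[OF inn d])
  have Uf: "U (f1 i) = f2 i" "U (J1 (f1 i)) = J2 (f2 i)" for i
    using U(4) by (auto simp: B_def ball_Un)
  have eqI: "F = G" if "bounded_linear F" "bounded_linear G"
      "\<And>i. F (f1 i) = G (f1 i)" "\<And>i. F (J1 (f1 i)) = G (J1 (f1 i))" for F G :: "'h1 \<Rightarrow> 'h2"
    using bounded_linear_eq_on_dense_span[OF that(1,2) d1] that(3,4) by (auto simp: D_def)
  note comp = bounded_linear_compose
  have "(\<lambda>x. U (J1 x)) = (\<lambda>x. J2 (U x))"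
    by (rule eqI) (auto intro!: comp[OF U(1)] comp[OF _ U(1)] cplx_structD(7) J1 J2
      simp: Uf cplx_structD(2)[OF J1] cplx_structD(2)[OF J2] linear_neg[OF bounded_linear.linear[OF U(1)]])
  moreover have "(\<lambda>x. U (S1 x)) = (\<lambda>x. S2 (U x))"
  proof (rule eqI)
    show "bounded_linear (\<lambda>x. U (S1 x))" "bounded_linear (\<lambda>x. S2 (U x))"
      using S1 S2 by (auto intro!: comp[OF U(1)] comp[OF _ U(1)] simp: bcl_def)
    \<comment> \<open>Both operators move the basis by the same map of indices.\<close>
    have *: "\<exists>j. S1 (f1 i) = f1 j \<and> S2 (f2 i) = f2 j" for i
    proof (cases i)
      case None
      then show ?thesis using e1 e2
        by (intro exI[of _ None]) (auto simp: bilateral_shift_basis_def f1_def f2_def)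
    next
      case (Some p)
      then show ?thesis using e1 e2
        by (cases p, intro exI[of _ "Some (fst p + 1, snd p)"])
          (auto simp: bilateral_shift_basis_def f1_def f2_def)
    qed
    show "U (S1 (f1 i)) = S2 (U (f1 i))" for i using *[of i] Uf by auto
    show "U (S1 (J1 (f1 i))) = S2 (U (J1 (f1 i)))" for i
      using *[of i] Uf S1 S2 by (auto simp: bcl_def)
  qed
  moreover have "U z1 = z2" using Uf(1)[of None] by (simp add: f1_def f2_def)
  ultimately show ?thesis
    using U(1-3) by (intro exI[of _ U]) (auto simp: unitary_map_def fun_eq_iff)
qed

text \<open>The abstract setting of a Wold-type decomposition, without any state or algebra.
  \<open>K_Inter\<close> is the assumption that carries the Kolmogorov property.\<close>

locale shift_filtration =
  fixes J S :: "'h::{real_inner,complete_space} \<Rightarrow> 'h" and z :: 'h and K :: "int \<Rightarrow> 'h set"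
  assumes J: "cplx_struct J" and S: "bcl J S" and S_inner: "inner (S x) (S y) = inner x y"
    and S_surj: "surj S" and S_fix: "S z = z" and norm_z: "norm z = 1"
    and K_subspace: "subspace (K n)" and K_closed: "closed (K n)"
    and K_J: "x \<in> K n \<Longrightarrow> J x \<in> K n"
    and K_Suc: "K n \<subseteq> K (n + 1)" and S_K: "S ` K n = K (n + 1)"
    and K_dense: "closure (\<Union>n. K n) = UNIV"
    and z_in_K: "z \<in> K n"
    and K_Inter: "(\<And>n. x \<in> K n) \<Longrightarrow> x = cscale J (cinner J z x) z"
begin

lemma K_mono: "m \<le> n \<Longrightarrow> K m \<subseteq> K n"
  by (induction n rule: int_ge_induct) (use K_Suc in blast)+

lemma S_bij: "bij S"
proof (rule bijI[OF _ S_surj])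
  have lin: "linear S" using S by (simp add: bcl_def bounded_linear.linear)
  show "inj S"
    unfolding linear_injective_0[OF lin] using S_inner by (metis inner_eq_zero_iff)
qed

definition S_pow :: "int \<Rightarrow> 'h \<Rightarrow> 'h" where
  "S_pow k = (if k \<ge> 0 then S ^^ nat k else inv S ^^ nat (- k))"

lemma S_pow_Suc: "S_pow (k + 1) x = S (S_pow k x)"
proof (cases "k \<ge> 0")
  case True
  then have "nat (k + 1) = Suc (nat k)" by simp
  with True show ?thesis by (simp add: S_pow_def)
next
  case False
  then have "nat (- k) = Suc (nat (- (k + 1)))" by simp
  with False have "S_pow k x = inv S ((inv S ^^ nat (- (k + 1))) x)" by (simp add: S_pow_def)
  then have "S (S_pow k x) = (inv S ^^ nat (- (k + 1))) x"
    using S_bij by (simp add: bij_is_surj surj_f_inv_f)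
  \<comment> \<open>At \<open>k = -1\<close> the exponent \<open>k + 1\<close> already falls under
    the nonnegative branch of the definition; both branches give the identity there.\<close>
  moreover have "S_pow (k + 1) x = (inv S ^^ nat (- (k + 1))) x"
    using False by (cases "k = -1") (auto simp: S_pow_def)
  ultimately show ?thesis by simp
qed

lemma S_pow_0: "S_pow 0 x = x" by (simp add: S_pow_def)

lemma S_pow_inner: "inner (S_pow k x) (S_pow k y) = inner x y"
proof (induction k rule: int_induct[where k=0])
  case base then show ?case by (simp add: S_pow_0)
next
  case (step1 i) then show ?case by (simp add: S_pow_Suc S_inner)
next
  case (step2 i) then show ?case
    using S_pow_Suc[of "i - 1" x] S_pow_Suc[of "i - 1" y] S_inner by simp
qed

lemma S_pow_J: "S_pow k (J x) = J (S_pow k x)"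
proof (induction k rule: int_induct[where k=0])
  case base then show ?case by (simp add: S_pow_0)
next
  case (step1 i) then show ?case using S by (simp add: S_pow_Suc bcl_def)
next
  \<comment> \<open>The downward step compares both sides after applying the injective
    \<open>S\<close>, so that nothing about \<open>inv S\<close> is needed.\<close>
  case (step2 i)
  then have "S (S_pow (i - 1) (J x)) = S (J (S_pow (i - 1) x))"
    using S_pow_Suc[of "i - 1"] S by (simp add: bcl_def)
  then show ?case using S_bij by (simp add: bij_is_inj inj_eq)
qed

lemma S_pow_K: "S_pow k ` K n = K (n + k)"
proof (induction k rule: int_induct[where k=0])
  case base then show ?case by (simp add: S_pow_0)
next
  case (step1 i)
  have "S_pow (i + 1) ` K n = S ` (S_pow i ` K n)" by (simp add: S_pow_Suc image_image)
  then show ?case using step1 S_K[of "n + i"] by (simp add: add.assoc)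
next
  case (step2 i)
  have "S ` (S_pow (i - 1) ` K n) = S_pow i ` K n"
    using S_pow_Suc[of "i - 1"] by (simp add: image_image)
  also have "\<dots> = S ` K (n + (i - 1))" using step2 S_K[of "n + (i - 1)"] by (simp add: add.assoc)
  finally show ?case using S_bij by (simp add: bij_is_inj inj_image_eq_iff)
qed

text \<open>The wandering subspace of the shift.\<close>

definition W :: "'h set" where "W = {x \<in> K 1. \<forall>y\<in>K 0. inner x y = 0}"

lemma W_subspace: "subspace W"
  using K_subspace[of 1] by (auto simp: W_def subspace_def inner_add_left)

lemma W_J: "x \<in> W \<Longrightarrow> J x \<in> W"
  using K_J by (auto simp: W_def cplx_structD(4)[OF J])

text \<open>Together the clauses identify the image of \<open>W\<close> under \<open>S_pow k\<close>
  with the orthogonal complement of \<open>K k\<close> in \<open>K (k + 1)\<close>.\<close>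

lemma S_pow_W:
  shows "x \<in> W \<Longrightarrow> S_pow k x \<in> K (k + 1)" and "x \<in> W \<Longrightarrow> y \<in> K k \<Longrightarrow> inner (S_pow k x) y = 0"
    and "\<lbrakk>u \<in> K (k + 1); \<And>y. y \<in> K k \<Longrightarrow> inner u y = 0\<rbrakk> \<Longrightarrow> u \<in> S_pow k ` W"
proof -
  show "S_pow k x \<in> K (k + 1)" if "x \<in> W"
    using that S_pow_K[of k 1] by (auto simp: W_def add.commute)
  show "inner (S_pow k x) y = 0" if "x \<in> W" "y \<in> K k"
  proof -
    obtain y' where "y' \<in> K 0" "y = S_pow k y'" using \<open>y \<in> K k\<close> S_pow_K[of k 0] by auto
    then show ?thesis using \<open>x \<in> W\<close> by (simp add: S_pow_inner W_def)
  qed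
  assume u: "u \<in> K (k + 1)" "\<And>y. y \<in> K k \<Longrightarrow> inner u y = 0"
  then obtain x where x: "x \<in> K 1" "u = S_pow k x" using S_pow_K[of k 1] by (auto simp: add.commute)
  have "inner x y = 0" if "y \<in> K 0" for y
    using u(2)[of "S_pow k y"] that S_pow_K[of k 0] x(2) S_pow_inner by auto
  with x show "u \<in> S_pow k ` W" by (auto simp: W_def)
qed

text \<open>Let \<open>p n\<close> be the projection of \<open>x\<close> onto \<open>K n\<close>.
  Each increment \<open>p (n + 1) - p n\<close> lies in a translate of \<open>W\<close>, to which
  \<open>x\<close> is orthogonal, so \<open>p\<close> is constant. Its value lies in every
  \<open>K n\<close>, hence is a multiple of \<open>z\<close>, hence is zero; so \<open>x\<close> is
  orthogonal to the dense union.\<close>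

lemma orthogonal_to_translates:
  assumes xz: "inner x z = 0" "inner x (J z) = 0"
    and xW: "\<And>k u. u \<in> W \<Longrightarrow> inner x (S_pow k u) = 0"
  shows "x = 0"
proof -
  have "\<exists>p. p \<in> K n \<and> (\<forall>u\<in>K n. inner (x - p) u = 0)" for n
    using closed_subspace_projection[OF K_subspace K_closed] by metis
  then obtain p where p: "\<And>n. p n \<in> K n" "\<And>n u. u \<in> K n \<Longrightarrow> inner (x - p n) u = 0" by metis
  have step: "p (n + 1) = p n" for n
  proof -
    let ?q = "p (n + 1) - p n"
    have qK: "?q \<in> K (n + 1)"
      using p(1) K_Suc K_subspace by (meson subsetD subspace_diff)
    have "inner ?q y = 0" if "y \<in> K n" for y
      using p(2)[OF that] p(2)[of y "n + 1"] K_Suc[of n] that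
      by (auto simp: inner_diff_left)
    with qK have "?q \<in> S_pow n ` W" by (intro S_pow_W(3))
    then have "inner x ?q = 0" using xW by auto
    moreover have "inner (x - p (n + 1)) ?q = 0" using p(2) qK by blast
    moreover have "inner (p n) ?q = 0"
      using \<open>\<And>y. y \<in> K n \<Longrightarrow> inner ?q y = 0\<close> p(1) by (metis inner_commute)
    ultimately have "inner ?q ?q = 0" by (simp add: inner_diff_left)
    then show ?thesis by simp
  qed
  have const: "p n = p 0" for n
  proof (induction n rule: int_induct[where k=0])
    case base then show ?case by simp
  next
    case (step1 i) then show ?case by (simp add: step)
  next
    case (step2 i) then show ?case using step[of "i - 1"] by simp
  qed
  have "p 0 \<in> K n" for n using p(1)[of n] const[of n] by simp
  then have "p 0 = cscale J (cinner J z (p 0)) z" by (rule K_Inter)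
  moreover have "inner z (p 0) = 0" "inner z (J (p 0)) = 0"
    using p(2)[OF z_in_K, of 0] p(2)[OF K_J[OF z_in_K], of 0] xz cplx_structD(4)[OF J, of z "p 0"]
    by (auto simp: inner_diff_left inner_commute[of _ "p 0"])
  ultimately have "p 0 = 0" by (simp add: cinner_def cscale_def)
  then have "inner x u = 0" if "u \<in> K n" for u n
    using p(2)[OF that] const[of n] by simp
  then have "inner x x = 0" using orthogonal_closure[of "\<Union>n. K n" x x] K_dense by blast
  then show ?thesis by simp
qed

text \<open>Vectors of different levels are orthogonal because the lower one lies in the subspace
  that the higher level avoids; within a level, \<open>S_pow k\<close> preserves inner products and
  commutes with \<open>J\<close>.\<close>

lemma S_pow_bilateral_shift_basis:
  assumes "range b \<subseteq> W" "complex_orthonormal J b"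
    and tot: "\<forall>x\<in>W. (\<forall>i. inner x (b i) = 0 \<and> inner x (J (b i)) = 0) \<longrightarrow> x = 0"
  shows "bilateral_shift_basis J S z (\<lambda>(k, n). S_pow k (b n))"
proof -
  let ?e = "\<lambda>(k, n). S_pow k (b n)"
  have bW: "b n \<in> W" for n using assms(1) by blast
  have on: "inner (b i) (b j) = (if i = j then 1 else 0)" "inner (b i) (J (b j)) = 0" for i j
    using assms(2) by (auto simp: complex_orthonormal_def)
  have lt: "inner (S_pow k u) (S_pow l v) = 0" if "k < l" "u \<in> W" "v \<in> W" for k l u v
  proof -
    have "S_pow k u \<in> K l" using S_pow_W(1)[OF that(2)] K_mono[of "k + 1" l] that(1) by auto
    then show ?thesis using S_pow_W(2)[OF that(3)] by (metis inner_commute)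
  qed
  have ne: "inner (S_pow k u) (S_pow l v) = 0" if "k \<noteq> l" "u \<in> W" "v \<in> W" for k l u v
    using lt[of k l u v] lt[of l k v u] that by (metis inner_commute linorder_neqE)
  have zW: "inner z (S_pow k u) = 0" "inner (S_pow k u) z = 0" if "u \<in> W" for k u
    using S_pow_W(2)[OF that z_in_K] by (auto simp: inner_commute)
  have zz: "inner z z = 1" using norm_z by (simp add: norm_eq_1)
  have ee: "inner (S_pow k (b n)) (S_pow l (b m)) = (if k = l \<and> n = m then 1 else 0)" for k l n m
    using ne[OF _ bW bW, of k l n m] by (cases "k = l") (auto simp: S_pow_inner on)
  have eJ: "inner (S_pow k (b n)) (J (S_pow l (b m))) = 0" for k l n m
    using ne[OF _ bW W_J[OF bW], of k l n m] by (cases "k = l") (auto simp: S_pow_inner on S_pow_J[symmetric])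
  have eJz: "inner (S_pow k (b n)) (J z) = 0" for k n
    using S_pow_W(2)[OF bW K_J[OF z_in_K]] by blast
  have zJe: "inner z (J (S_pow k (b n))) = 0" for k n
    using zW(1)[OF W_J[OF bW]] by (simp add: S_pow_J)
  have "complex_orthonormal J (case_option z ?e)"
    unfolding complex_orthonormal_def
    by (auto split: option.splits simp: zz zW[OF bW] ee eJ eJz zJe cplx_structD(5)[OF J])
  moreover have "x = 0"
    if x: "\<forall>i. inner x (case_option z ?e i) = 0 \<and> inner x (J (case_option z ?e i)) = 0" for x
  proof (rule orthogonal_to_translates)
    show "inner x z = 0" "inner x (J z) = 0" using x[rule_format, of None] by auto
    fix k u assume u: "u \<in> W"
    have xe: "inner x (S_pow k (b n)) = 0" "inner x (J (S_pow k (b n))) = 0" for n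
      using x[rule_format, of "Some (k, n)"] by auto
    \<comment> \<open>Level \<open>k\<close> written as an orthogonal complement, a form in which
      closedness is immediate.\<close>
    let ?V = "{v \<in> K (k + 1). \<forall>y\<in>K k. inner v y = 0}"
    have VW: "?V = S_pow k ` W" using S_pow_W by blast
    have "subspace ?V"
      using K_subspace[of "k + 1"] by (auto simp: subspace_def inner_add_left)
    moreover have "closed ?V"
    proof -
      have "?V = K (k + 1) \<inter> (\<Inter>y\<in>K k. {v. inner v y = 0})" by auto
      moreover have "closed {v. inner v y = 0}" for y :: 'h
        by (intro closed_Collect_eq continuous_intros)
      ultimately show ?thesis using K_closed by (auto intro!: closed_Int closed_INT)
    qed
    ultimately obtain q where q: "q \<in> ?V" "\<And>v. v \<in> ?V \<Longrightarrow> inner (x - q) v = 0"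
      using closed_subspace_projection[of ?V x] by blast
    from q(1) VW obtain u0 where u0: "u0 \<in> W" "q = S_pow k u0" by blast
    have qx: "inner q (S_pow k v) = inner x (S_pow k v)" if "v \<in> W" for v
      using q(2)[of "S_pow k v"] that VW by (auto simp: inner_diff_left)
    \<comment> \<open>The projection \<open>q\<close> of \<open>x\<close> onto level
      \<open>k\<close> has the same inner products with that level as \<open>x\<close>; pulled back
      to \<open>W\<close> it is therefore orthogonal to the whole basis.\<close>
    have "inner u0 (b n) = 0" "inner u0 (J (b n)) = 0" for n
      using qx[OF bW, of n] qx[OF W_J[OF bW], of n] xe[of n] by (auto simp: u0(2) S_pow_inner S_pow_J[of k "b n",symmetric])
    with tot u0(1) have "u0 = 0" by blast
    then have "inner q (S_pow k u) = 0" by (simp add: u0(2) S_pow_inner)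
    with qx[OF u] show "inner x (S_pow k u) = 0" by simp
  qed
  ultimately show ?thesis
    unfolding bilateral_shift_basis_def using S_fix by (auto simp: S_pow_Suc)
qed

end

section \<open>The local algebra\<close>

lemma local_obs_finite: "local_obs L M \<Longrightarrow> finite L"
  by (simp add: local_obs_def)

lemma local_obs_off: "local_obs L M \<Longrightarrow> M s t \<noteq> 0 \<Longrightarrow> j \<notin> L \<Longrightarrow> s j = t j"
  unfolding local_obs_def by blast

lemma local_obs_cong:
  assumes "local_obs L M" "\<And>j. j \<in> L \<Longrightarrow> s j = s' j" "\<And>j. j \<in> L \<Longrightarrow> t j = t' j"
    "\<And>j. j \<notin> L \<Longrightarrow> s j = t j" "\<And>j. j \<notin> L \<Longrightarrow> s' j = t' j"
  shows "M s t = M s' t'"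
proof -
  have "(\<forall>j\<in>L. s j = s' j \<and> t j = t' j) \<and> (\<forall>j. j \<notin> L \<longrightarrow> s j = t j \<and> s' j = t' j)"
    using assms(2-5) by blast
  then show ?thesis using assms(1) unfolding local_obs_def by blast
qed

lemma local_obsI:
  fixes M :: "'a obs"
  assumes "finite L" "\<And>s t j. M s t \<noteq> 0 \<Longrightarrow> j \<notin> L \<Longrightarrow> s j = t j"
    "\<And>s t s' t'. \<lbrakk>\<And>j. j \<in> L \<Longrightarrow> s j = s' j; \<And>j. j \<in> L \<Longrightarrow> t j = t' j;
      \<And>j. j \<notin> L \<Longrightarrow> s j = t j; \<And>j. j \<notin> L \<Longrightarrow> s' j = t' j\<rbrakk> \<Longrightarrow> M s t = M s' t'"
  shows "local_obs L M"
  unfolding local_obs_def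
proof (intro conjI allI impI)
  fix s t s' t' :: "int \<Rightarrow> 'a"
  assume "(\<forall>j\<in>L. s j = s' j \<and> t j = t' j) \<and> (\<forall>j. j \<notin> L \<longrightarrow> s j = t j \<and> s' j = t' j)"
  then show "M s t = M s' t'" by (intro assms(3)) auto
next
  show "finite L" by (rule assms(1))
  show "s j = t j" if "M s t \<noteq> 0" "j \<notin> L" for s t j by (rule assms(2)[OF that])
qed

lemma local_obs_mono:
  fixes M :: "'a obs"
  assumes M: "local_obs L M" and L: "L \<subseteq> L'" "finite L'"
  shows "local_obs L' M"
proof (rule local_obsI[OF L(2)])
  show "s j = t j" if "M s t \<noteq> 0" "j \<notin> L'" for s t j
    using local_obs_off[OF M, of s t j] that L(1) by auto
  fix s t s' t' :: "int \<Rightarrow> 'a"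
  assume *: "\<And>j. j \<in> L' \<Longrightarrow> s j = s' j" "\<And>j. j \<in> L' \<Longrightarrow> t j = t' j"
    "\<And>j. j \<notin> L' \<Longrightarrow> s j = t j" "\<And>j. j \<notin> L' \<Longrightarrow> s' j = t' j"
  show "M s t = M s' t'"
  proof (cases "\<forall>j. j \<notin> L \<longrightarrow> s j = t j")
    case True
    then have "s' j = t' j" if "j \<notin> L" for j using * that by metis
    with True * L(1) show ?thesis by (intro local_obs_cong[OF M]) auto
  next
    \<comment> \<open>The disagreement must occur inside the larger region, so it is shared by
      \<open>s'\<close> and \<open>t'\<close>, and both entries vanish.\<close>
    case False
    then obtain j where j: "j \<notin> L" "s j \<noteq> t j" by blast
    then have "s' j \<noteq> t' j" using * by metis
    with j have "M s t = 0" "M s' t' = 0" using local_obs_off[OF M] by blast+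
    then show ?thesis by simp
  qed
qed

text \<open>Pinning the values off \<open>L\<close> to \<open>undefined\<close>, as
  \<open>product_state\<close> does, makes this a finite set of representatives.\<close>

definition configs :: "int set \<Rightarrow> (int \<Rightarrow> 'd) set" where
  "configs L = {s. \<forall>j. j \<notin> L \<longrightarrow> s j = undefined}"

lemma configs_eq_PiE: "configs L = PiE L (\<lambda>_. UNIV)"
  by (auto simp: configs_def PiE_def extensional_def)

lemma finite_configs: "finite L \<Longrightarrow> finite (configs L :: (int \<Rightarrow> 'd::finite) set)"
  by (simp add: configs_eq_PiE finite_PiE)

lemma card_configs: "finite L \<Longrightarrow> card (configs L :: (int \<Rightarrow> 'd::finite) set) = CARD('d) ^ card L"
  by (simp add: configs_eq_PiE card_PiE)

lemma configs_eqI: "s \<in> configs L \<Longrightarrow> t \<in> configs L \<Longrightarrow> (\<And>j. j \<in> L \<Longrightarrow> s j = t j) \<Longrightarrow> s = t"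
  unfolding configs_def by (auto simp: fun_eq_iff) metis

lemma obs_row_subset:
  assumes M: "local_obs L M"
  shows "{r. M s r \<noteq> 0} \<subseteq> (\<lambda>c. override_on s c L) ` configs L"
proof
  fix r assume "r \<in> {r. M s r \<noteq> 0}"
  then have "r = override_on s (override_on (\<lambda>_. undefined) r L) L"
    using local_obs_off[OF M, of s r] by (auto simp: fun_eq_iff override_on_def)
  moreover have "override_on (\<lambda>_. undefined) r L \<in> configs L"
    by (auto simp: configs_def override_on_def)
  ultimately show "r \<in> (\<lambda>c. override_on s c L) ` configs L" by blast
qed

lemma finite_obs_row:
  fixes M :: "'d::finite obs"
  assumes "local_obs L M"
  shows "finite {r. M s r \<noteq> 0}"
  by (rule finite_subset[OF obs_row_subset[OF assms]])
    (simp add: finite_configs[OF local_obs_finite[OF assms]])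

text \<open>The index set of the sum no longer depends on the row \<open>s\<close>, so products at
  different rows can be compared term by term.\<close>

lemma obs_mult_eq_sum:
  fixes M :: "'d::finite obs"
  assumes M: "local_obs L M"
  shows "obs_mult M N s t = (\<Sum>c\<in>configs L. M s (override_on s c L) * N (override_on s c L) t)"
proof -
  let ?g = "\<lambda>c. override_on s c L"
  have inj: "inj_on ?g (configs L)"
  proof (rule inj_onI)
    fix c c' assume c: "c \<in> configs L" "c' \<in> configs L" "?g c = ?g c'"
    show "c = c'"
      by (rule configs_eqI[OF c(1,2)]) (use c(3) in \<open>auto simp: fun_eq_iff override_on_def split: if_splits\<close>)
  qed
  have "obs_mult M N s t = (\<Sum>r\<in>?g ` configs L. M s r * N r t)"
    unfolding obs_mult_def using obs_row_subset[OF M] finite_configs[OF local_obs_finite[OF M]]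
    by (intro sum.mono_neutral_left) auto
  also have "\<dots> = (\<Sum>c\<in>configs L. M s (?g c) * N (?g c) t)"
    using sum.reindex[OF inj] by (simp add: o_def)
  finally show ?thesis .
qed

lemma local_obs_mult:
  fixes M N :: "'d::finite obs"
  assumes M: "local_obs L M" and N: "local_obs L N"
  shows "local_obs L (obs_mult M N)"
proof (rule local_obsI[OF local_obs_finite[OF M]])
  fix s t :: "int \<Rightarrow> 'd" and j
  assume nz: "obs_mult M N s t \<noteq> 0" and j: "j \<notin> L"
  obtain r where "M s r * N r t \<noteq> 0"
    using nz unfolding obs_mult_def by (meson sum.neutral)
  then show "s j = t j" using local_obs_off[OF M, of s r j] local_obs_off[OF N, of r t j] j by simp
next
  fix s t s' t' :: "int \<Rightarrow> 'd"
  assume *: "\<And>j. j \<in> L \<Longrightarrow> s j = s' j" "\<And>j. j \<in> L \<Longrightarrow> t j = t' j"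
    "\<And>j. j \<notin> L \<Longrightarrow> s j = t j" "\<And>j. j \<notin> L \<Longrightarrow> s' j = t' j"
  show "obs_mult M N s t = obs_mult M N s' t'"
    unfolding obs_mult_eq_sum[OF M]
  proof (rule sum.cong[OF refl])
    fix c :: "int \<Rightarrow> 'd"
    have "M s (override_on s c L) = M s' (override_on s' c L)"
      by (rule local_obs_cong[OF M]) (auto simp: * override_on_def)
    moreover have "N (override_on s c L) t = N (override_on s' c L) t'"
      by (rule local_obs_cong[OF N]) (auto simp: * override_on_def)
    ultimately show "M s (override_on s c L) * N (override_on s c L) t =
        M s' (override_on s' c L) * N (override_on s' c L) t'" by simp
  qed
qed

lemma local_obs_add: "local_obs L M \<Longrightarrow> local_obs L N \<Longrightarrow> local_obs L (obs_add M N)"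
  apply (rule local_obsI, erule local_obs_finite)
  subgoal for s t j using local_obs_off[of L M s t j] local_obs_off[of L N s t j]
    by (cases "M s t = 0") (auto simp: obs_add_def)
  subgoal for s t s' t' using local_obs_cong[of L M s s' t t'] local_obs_cong[of L N s s' t t']
    by (simp add: obs_add_def)
  done

lemma local_obs_scale: "local_obs L M \<Longrightarrow> local_obs L (obs_scale c M)"
  apply (rule local_obsI, erule local_obs_finite)
  subgoal for s t j using local_obs_off[of L M s t j] by (auto simp: obs_scale_def)
  subgoal for s t s' t' using local_obs_cong[of L M s s' t t'] by (simp add: obs_scale_def)
  done

lemma local_obs_adj: "local_obs L M \<Longrightarrow> local_obs L (obs_adj M)"
  apply (rule local_obsI, erule local_obs_finite)
  subgoal for s t j using local_obs_off[of L M t s j] by (auto simp: obs_adj_def)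
  subgoal for s t s' t' using local_obs_cong[of L M t t' s s'] by (simp add: obs_adj_def)
  done

lemma local_obs_one: "finite L \<Longrightarrow> local_obs L obs_one"
proof (rule local_obsI)
  fix s t s' t' :: "int \<Rightarrow> 'a"
  assume *: "\<And>j. j \<in> L \<Longrightarrow> s j = s' j" "\<And>j. j \<in> L \<Longrightarrow> t j = t' j"
    "\<And>j. j \<notin> L \<Longrightarrow> s j = t j" "\<And>j. j \<notin> L \<Longrightarrow> s' j = t' j"
  have "s = t \<longleftrightarrow> s' = t'" unfolding fun_eq_iff using * by metis
  then show "obs_one s t = obs_one s' t'" by (simp add: obs_one_def)
qed (auto simp: obs_one_def split: if_splits)

lemma local_obs_zero: "finite L \<Longrightarrow> local_obs L (\<lambda>_ _. 0)"
  by (rule local_obsI) auto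

lemma local_obs_shift:
  assumes M: "local_obs L M"
  shows "local_obs ((\<lambda>j. j + n) ` L) (shift n M)"
proof (rule local_obsI)
  show "finite ((\<lambda>j. j + n) ` L)" using local_obs_finite[OF M] by simp
  have im: "j \<in> (\<lambda>j. j + n) ` L \<longleftrightarrow> j - n \<in> L" for j
    by (auto simp: image_iff) (metis diff_add_cancel)
  show "s j = t j" if "shift n M s t \<noteq> 0" "j \<notin> (\<lambda>j. j + n) ` L" for s t j
    using local_obs_off[OF M, of "\<lambda>j. s (j + n)" "\<lambda>j. t (j + n)" "j - n"] that
    by (simp add: shift_def im)
  fix s t s' t' :: "int \<Rightarrow> 'a"
  assume "\<And>j. j \<in> (\<lambda>j. j + n) ` L \<Longrightarrow> s j = s' j" "\<And>j. j \<in> (\<lambda>j. j + n) ` L \<Longrightarrow> t j = t' j"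
    "\<And>j. j \<notin> (\<lambda>j. j + n) ` L \<Longrightarrow> s j = t j" "\<And>j. j \<notin> (\<lambda>j. j + n) ` L \<Longrightarrow> s' j = t' j"
  then show "shift n M s t = shift n M s' t'"
    unfolding shift_def im by (intro local_obs_cong[OF M]) simp_all
qed

lemma shift_shift: "shift m (shift n M) = shift (n + m) M"
  by (simp add: shift_def fun_eq_iff add.assoc)

lemma shift_0: "shift 0 M = M"
  by (simp add: shift_def fun_eq_iff)

lemma shift_adj: "shift n (obs_adj M) = obs_adj (shift n M)"
  by (simp add: shift_def obs_adj_def fun_eq_iff)

lemma shift_mult: "shift n (obs_mult M N) = obs_mult (shift n M) (shift n N)"
proof (intro ext)
  fix s t :: "int \<Rightarrow> 'a"
  show "shift n (obs_mult M N) s t = obs_mult (shift n M) (shift n N) s t"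
    unfolding shift_def obs_mult_def
    by (rule sum.reindex_bij_witness[of _ "\<lambda>r j. r (j + n)" "\<lambda>r j. r (j - n)"]) auto
qed

lemma shift_one: "shift n obs_one = obs_one"
proof (intro ext)
  fix s t :: "int \<Rightarrow> 'a"
  have "(\<lambda>j. s (j + n)) = (\<lambda>j. t (j + n)) \<longleftrightarrow> s = t"
    unfolding fun_eq_iff by (metis diff_add_cancel)
  then show "shift n obs_one s t = obs_one s t" by (simp add: shift_def obs_one_def)
qed

text \<open>A contributing intermediate configuration agrees with \<open>s\<close> off
  \<open>L1\<close> and with \<open>t\<close> off \<open>L2\<close>, in particular on
  \<open>L1\<close>. Only one configuration does so.\<close>

lemma obs_mult_disjoint:
  fixes M :: "'d::finite obs"
  assumes M: "local_obs L1 M" and N: "local_obs L2 N" and disj: "L1 \<inter> L2 = {}"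
  shows "obs_mult M N s t = M s (override_on s t L1) * N (override_on s t L1) t"
proof -
  let ?r = "override_on s t L1"
  have "r = ?r" if "M s r * N r t \<noteq> 0" for r
  proof
    fix j
    show "r j = ?r j"
      using local_obs_off[OF M, of s r j] local_obs_off[OF N, of r t j] that disj
      by (cases "j \<in> L1") (auto simp: override_on_def)
  qed
  then have "obs_mult M N s t = (\<Sum>r\<in>{r. M s r \<noteq> 0}. if r = ?r then M s ?r * N ?r t else 0)"
    unfolding obs_mult_def by (intro sum.cong) auto
  also have "\<dots> = M s ?r * N ?r t"
    using finite_obs_row[OF M] by (simp add: sum.delta)
  finally show ?thesis .
qed

text \<open>In either order a single intermediate configuration survives. The two differ, but each
  factor sees only its own sites, where it is read from the row \<open>s\<close> to the column
  \<open>t\<close> in both cases.\<close>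

lemma obs_mult_commute_disjoint:
  fixes M N :: "'d::finite obs"
  assumes M: "local_obs L1 M" and N: "local_obs L2 N" and disj: "L1 \<inter> L2 = {}"
  shows "obs_mult M N = obs_mult N M"
proof (intro ext)
  fix s t :: "int \<Rightarrow> 'd"
  let ?r = "override_on s t L1" and ?q = "override_on s t L2"
  have 1: "obs_mult M N s t = M s ?r * N ?r t" by (rule obs_mult_disjoint[OF assms])
  have 2: "obs_mult N M s t = N s ?q * M ?q t"
    by (rule obs_mult_disjoint[OF N M]) (use disj in blast)
  show "obs_mult M N s t = obs_mult N M s t"
  proof (cases "\<forall>j. j \<notin> L1 \<union> L2 \<longrightarrow> s j = t j")
    case True
    have "M s ?r = M ?q t"
      by (rule local_obs_cong[OF M]) (use disj True in \<open>auto simp: override_on_def\<close>)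
    moreover have "N ?r t = N s ?q"
      by (rule local_obs_cong[OF N]) (use disj True in \<open>auto simp: override_on_def\<close>)
    ultimately show ?thesis using 1 2 by simp
  next
    case False
    then obtain j where j: "j \<notin> L1" "j \<notin> L2" "s j \<noteq> t j" by auto
    then have "N ?r t = 0" "M ?q t = 0"
      using local_obs_off[OF N, of ?r t j] local_obs_off[OF M, of ?q t j] by (auto simp: override_on_def)
    then show ?thesis using 1 2 by simp
  qed
qed

section \<open>Matrix units of a finite region: \<open>|a><b|\<close> on \<open>L\<close>, tensored
  with the identity elsewhere\<close>

definition matrix_unit :: "int set \<Rightarrow> (int \<Rightarrow> 'd) \<Rightarrow> (int \<Rightarrow> 'd) \<Rightarrow> 'd obs" where
  "matrix_unit L a b s t =
     (if (\<forall>j\<in>L. s j = a j \<and> t j = b j) \<and> (\<forall>j. j \<notin> L \<longrightarrow> s j = t j) then 1 else 0)"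

lemma local_obs_matrix_unit: "finite L \<Longrightarrow> local_obs L (matrix_unit L a b)"
  by (rule local_obsI) (auto simp: matrix_unit_def split: if_splits)

lemma matrix_unit_adj: "obs_adj (matrix_unit L a b) = matrix_unit L b a"
  by (auto simp: matrix_unit_def obs_adj_def fun_eq_iff)

lemma matrix_unit_mult:
  "obs_mult (matrix_unit L a b) (matrix_unit L b' c) =
     (if \<forall>j\<in>L. b j = b' j then matrix_unit L a c else (\<lambda>_ _. 0))"
proof (intro ext)
  fix s t :: "int \<Rightarrow> 'a"
  have row: "{r. matrix_unit L a b s r \<noteq> 0} =
      (if \<forall>j\<in>L. s j = a j then {override_on s b L} else {})"
    by (auto simp: matrix_unit_def override_on_def fun_eq_iff split: if_splits) metis
  show "obs_mult (matrix_unit L a b) (matrix_unit L b' c) s t =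
     (if \<forall>j\<in>L. b j = b' j then matrix_unit L a c else (\<lambda>_ _. 0)) s t"
    unfolding obs_mult_def row by (auto simp: matrix_unit_def override_on_def)
qed

text \<open>At \<open>(s, t)\<close> the only term that can survive is the pair of restrictions of
  \<open>s\<close> and \<open>t\<close> to \<open>L\<close>, since elements of
  \<open>configs L\<close> are determined by their values on \<open>L\<close>.\<close>

lemma matrix_unit_expansion:
  fixes M :: "'d::finite obs"
  assumes M: "local_obs L M"
  shows "M = (\<lambda>s t. \<Sum>p\<in>configs L \<times> configs L. obs_scale (M (fst p) (snd p)) (matrix_unit L (fst p) (snd p)) s t)"
proof (intro ext)
  fix s t
  let ?c = "\<lambda>s. override_on (\<lambda>_. undefined) s L"
  have fin: "finite (configs L \<times> configs L :: ((int \<Rightarrow> 'd) \<times> (int \<Rightarrow> 'd)) set)"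
    using finite_configs[OF local_obs_finite[OF M]] by blast
  have mem: "?c s \<in> configs L" for s :: "int \<Rightarrow> 'd" by (auto simp: configs_def override_on_def)
  have eq: "a = ?c s" if "a \<in> configs L" "\<forall>j\<in>L. s j = a j" for a s :: "int \<Rightarrow> 'd"
    by (rule configs_eqI[OF that(1) mem]) (use that(2) in \<open>auto simp: override_on_def\<close>)
  have "(\<Sum>p\<in>configs L \<times> configs L. obs_scale (M (fst p) (snd p)) (matrix_unit L (fst p) (snd p)) s t)
      = (\<Sum>p\<in>configs L \<times> configs L. if p = (?c s, ?c t) then M s t else 0)"
  proof (rule sum.cong[OF refl])
    fix p :: "(int \<Rightarrow> 'd) \<times> (int \<Rightarrow> 'd)"
    assume p: "p \<in> configs L \<times> configs L"
    show "obs_scale (M (fst p) (snd p)) (matrix_unit L (fst p) (snd p)) s t =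
        (if p = (?c s, ?c t) then M s t else 0)"
    proof (cases "p = (?c s, ?c t)")
      case True
      show ?thesis
      proof (cases "\<forall>j. j \<notin> L \<longrightarrow> s j = t j")
        case t: True
        have "M (?c s) (?c t) = M s t"
          by (rule local_obs_cong[OF M]) (use t in \<open>auto simp: override_on_def\<close>)
        with True t show ?thesis by (auto simp: obs_scale_def matrix_unit_def override_on_def)
      next
        case False
        then have "M s t = 0" using local_obs_off[OF M] by blast
        with True False show ?thesis by (auto simp: obs_scale_def matrix_unit_def)
      qed
    next
      case False
      then have "\<not> (\<forall>j\<in>L. s j = fst p j \<and> t j = snd p j)"
        using p eq[of "fst p" s] eq[of "snd p" t] by (metis mem_Times_iff prod.collapse)
      then show ?thesis using False by (auto simp: obs_scale_def matrix_unit_def)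
    qed
  qed
  also have "\<dots> = M s t" using fin mem by (simp add: sum.delta)
  finally show "M s t = (\<Sum>p\<in>configs L \<times> configs L.
      obs_scale (M (fst p) (snd p)) (matrix_unit L (fst p) (snd p)) s t)" by simp
qed

section \<open>The product state\<close>

text \<open>The value of \<open>product_state\<close> with the region made explicit, instead of
  chosen by \<open>SOME\<close>.\<close>

definition product_value :: "complex ^ 'd \<Rightarrow> int set \<Rightarrow> 'd obs \<Rightarrow> complex" where
  "product_value lam L M = (\<Sum>s\<in>configs L. \<Sum>t\<in>configs L.
     cnj (\<Prod>j\<in>L. lam $ s j) * M s t * (\<Prod>j\<in>L. lam $ t j))"

lemma sum_configs_Un:
  assumes "L1 \<inter> L2 = {}"
  shows "(\<Sum>s\<in>configs (L1 \<union> L2). f s) = (\<Sum>a\<in>configs L1. \<Sum>b\<in>configs L2. f (override_on b a L1))"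
  unfolding sum.cartesian_product
proof (rule sum.reindex_bij_witness[of _ "\<lambda>(a, b). override_on b a L1"
      "\<lambda>s. (override_on (\<lambda>_. undefined) s L1, override_on (\<lambda>_. undefined) s L2)"])
qed (use assms in \<open>auto simp: configs_def override_on_def fun_eq_iff intro!: arg_cong[where f=f]\<close>)

lemma prod_override_on_Un:
  assumes "finite L1" "finite L2" "L1 \<inter> L2 = {}"
  shows "(\<Prod>j\<in>L1 \<union> L2. g (override_on b a L1 j)) = (\<Prod>j\<in>L1. g (a j)) * (\<Prod>j\<in>L2. g (b j) :: complex)"
proof -
  have "(\<Prod>j\<in>L1 \<union> L2. g (override_on b a L1 j)) =
      (\<Prod>j\<in>L1. g (override_on b a L1 j)) * (\<Prod>j\<in>L2. g (override_on b a L1 j))"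
    using assms by (rule prod.union_disjoint)
  also have "(\<Prod>j\<in>L1. g (override_on b a L1 j)) = (\<Prod>j\<in>L1. g (a j))"
    by (intro prod.cong) (auto simp: override_on_def)
  also have "(\<Prod>j\<in>L2. g (override_on b a L1 j)) = (\<Prod>j\<in>L2. g (b j))"
    using assms(3) by (intro prod.cong) (auto simp: override_on_def)
  finally show ?thesis .
qed

text \<open>A configuration on the union is a pair of configurations, and both the product vector
  and the matrix entry factorize along this splitting.\<close>

lemma product_value_mult_disjoint:
  fixes M N :: "'d::finite obs"
  assumes M: "local_obs L1 M" and N: "local_obs L2 N" and disj: "L1 \<inter> L2 = {}"
  shows "product_value lam (L1 \<union> L2) (obs_mult M N) = product_value lam L1 M * product_value lam L2 N"
proof -
  have fin: "finite L1" "finite L2" using M N local_obs_finite by blast+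
  define A where "A a a' = cnj (\<Prod>j\<in>L1. lam $ a j) * M a a' * (\<Prod>j\<in>L1. lam $ a' j)" for a a'
  define B where "B b b' = cnj (\<Prod>j\<in>L2. lam $ b j) * N b b' * (\<Prod>j\<in>L2. lam $ b' j)" for b b'
  have entry: "obs_mult M N (override_on b a L1) (override_on b' a' L1) = M a a' * N b b'"
    if "a \<in> configs L1" "a' \<in> configs L1" "b \<in> configs L2" "b' \<in> configs L2" for a a' b b'
  proof -
    let ?s = "override_on b a L1" and ?t = "override_on b' a' L1"
    have "M ?s (override_on ?s ?t L1) = M a a'"
      by (rule local_obs_cong[OF M]) (use that in \<open>auto simp: override_on_def configs_def\<close>)
    moreover have "N (override_on ?s ?t L1) ?t = N b b'"
      by (rule local_obs_cong[OF N]) (use that disj in \<open>auto simp: override_on_def configs_def\<close>)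
    ultimately show ?thesis by (simp add: obs_mult_disjoint[OF assms])
  qed
  have "product_value lam (L1 \<union> L2) (obs_mult M N) =
      (\<Sum>a\<in>configs L1. \<Sum>b\<in>configs L2. \<Sum>a'\<in>configs L1. \<Sum>b'\<in>configs L2. A a a' * B b b')"
    unfolding product_value_def sum_configs_Un[OF disj]
    by (intro sum.cong refl)
      (simp add: prod_override_on_Un[OF fin disj, where g="\<lambda>x. lam $ x"] entry A_def B_def)
  also have "\<dots> = (\<Sum>a\<in>configs L1. \<Sum>a'\<in>configs L1. \<Sum>b\<in>configs L2. \<Sum>b'\<in>configs L2. A a a' * B b b')"
    by (rule sum.cong[OF refl], rule sum.swap)
  also have "\<dots> = (\<Sum>a\<in>configs L1. \<Sum>a'\<in>configs L1. A a a') * (\<Sum>b\<in>configs L2. \<Sum>b'\<in>configs L2. B b b')"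
    by (simp add: sum_distrib_left[symmetric] sum_distrib_right[symmetric])
  finally show ?thesis by (simp add: product_value_def A_def B_def)
qed

text \<open>The diagonal sum over configurations is the product over the sites of the squared norm
  of \<open>lam\<close>.\<close>

lemma product_value_one:
  fixes lam :: "complex ^ 'd::finite"
  assumes "norm lam = 1" "finite L"
  shows "product_value lam L obs_one = 1"
proof -
  have "(\<Sum>a\<in>UNIV. (norm (lam $ a))\<^sup>2) = 1"
    using assms(1) by (simp add: norm_vec_def L2_set_def)
  then have unit: "(\<Sum>a\<in>UNIV. cnj (lam $ a) * lam $ a) = 1"
    by (simp add: mult.commute[of "cnj _"] complex_norm_square[symmetric] of_real_sum[symmetric]
        of_real_power[symmetric] del: of_real_sum of_real_power)
  have "product_value lam L obs_one =
      (\<Sum>s\<in>configs L. \<Sum>t\<in>configs L. if s = t then \<Prod>j\<in>L. cnj (lam $ s j) * lam $ s j else 0)"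
    unfolding product_value_def by (intro sum.cong) (auto simp: obs_one_def prod.distrib)
  also have "\<dots> = (\<Sum>s\<in>configs L. \<Prod>j\<in>L. cnj (lam $ s j) * lam $ s j)"
    using finite_configs[OF assms(2), where 'd='d] by simp
  also have "\<dots> = (\<Prod>j\<in>L. \<Sum>a\<in>UNIV. cnj (lam $ a) * lam $ a)"
    unfolding configs_eq_PiE using assms(2) by (subst prod_sum_PiE) auto
  finally show ?thesis by (simp add: unit)
qed

lemma obs_mult_one_right:
  fixes M :: "'d::finite obs"
  assumes "local_obs L M"
  shows "obs_mult M obs_one = M"
proof (intro ext)
  fix s t
  have "obs_mult M obs_one s t = (\<Sum>r\<in>{r. M s r \<noteq> 0}. if r = t then M s r else 0)"
    unfolding obs_mult_def by (intro sum.cong) (auto simp: obs_one_def)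
  then show "obs_mult M obs_one s t = M s t"
    using finite_obs_row[OF assms, of s] by (simp add: sum.delta')
qed

text \<open>The observable is padded with the identity on the extra sites, which contributes the
  factor 1.\<close>

lemma product_value_superset:
  fixes M :: "'d::finite obs"
  assumes lam: "norm lam = 1" and M: "local_obs L M" and L': "L \<subseteq> L'" "finite L'"
  shows "product_value lam L' M = product_value lam L M"
proof -
  have fin: "finite (L' - L)" using L'(2) by simp
  have "L \<union> (L' - L) = L'" using L'(1) by blast
  then show ?thesis
    using product_value_mult_disjoint[OF M local_obs_one[OF fin], of lam]
    by (simp add: obs_mult_one_right[OF M] product_value_one[OF lam fin])
qed

text \<open>Independence of the chosen support: the given region and the one selected by
  \<open>SOME\<close> are both compared with their union.\<close>

lemma product_state_eq:
  fixes M :: "'d::finite obs"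
  assumes lam: "norm lam = 1" and M: "local_obs L M"
  shows "product_state lam M = product_value lam L M"
proof -
  define L' where "L' = (SOME L. local_obs L M)"
  have L': "local_obs L' M" unfolding L'_def using M by (rule someI)
  have fin: "finite (L \<union> L')" using M L' local_obs_finite by blast
  have "product_state lam M = product_value lam L' M"
    by (simp add: product_state_def product_value_def configs_def L'_def Let_def)
  also have "\<dots> = product_value lam (L \<union> L') M"
    using product_value_superset[OF lam L' _ fin] by simp
  also have "\<dots> = product_value lam L M"
    using product_value_superset[OF lam M _ fin] by simp
  finally show ?thesis .
qed

lemma product_state_translation_invariant:
  fixes lam :: "complex ^ 'd::finite"
  assumes lam: "norm lam = 1"
  shows "translation_invariant (product_state lam)"
  unfolding translation_invariant_def
proof
  fix M :: "'d obs" assume "M \<in> Bloc"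
  then obtain L where M: "local_obs L M" by (auto simp: Bloc_def)
  let ?L = "(\<lambda>j. j + 1) ` L"
  have im: "j \<in> ?L \<longleftrightarrow> j - 1 \<in> L" for j
    by (auto simp: image_iff) (metis diff_add_cancel)
  have re: "(\<Sum>s\<in>configs ?L. f s) = (\<Sum>s\<in>configs L. f (\<lambda>j. s (j - 1)))" for f :: "(int \<Rightarrow> 'd) \<Rightarrow> complex"
    by (rule sum.reindex_bij_witness[of _ "\<lambda>s j. s (j - 1)" "\<lambda>s j. s (j + 1)"])
      (auto simp: configs_def im)
  have pr: "(\<Prod>j\<in>?L. g j) = (\<Prod>j\<in>L. g (j + 1))" for g :: "int \<Rightarrow> complex"
    by (subst prod.reindex) (auto simp: inj_on_def)
  have "product_value lam ?L (shift 1 M) = product_value lam L M"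
    unfolding product_value_def re pr by (simp add: shift_def)
  then show "product_state lam (shift 1 M) = product_state lam M"
    by (simp add: product_state_eq[OF lam M] product_state_eq[OF lam local_obs_shift[OF M]])
qed

lemma product_state_mult_disjoint:
  fixes M N :: "'d::finite obs"
  assumes "norm lam = 1" and M: "local_obs L1 M" and N: "local_obs L2 N" and "L1 \<inter> L2 = {}"
  shows "product_state lam (obs_mult M N) = product_state lam M * product_state lam N"
proof -
  have "finite (L1 \<union> L2)" using M N local_obs_finite by blast
  then have "local_obs (L1 \<union> L2) (obs_mult M N)"
    by (intro local_obs_mult local_obs_mono[OF M] local_obs_mono[OF N]) auto
  then show ?thesis
    using assms by (simp add: product_state_eq product_value_mult_disjoint)
qed

section \<open>The filtration of a GNS space by the left half-chains\<close>

text \<open>The counterpart of \<open>Bloc_from\<close>: its elements commute with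
  \<open>Bloc_from (n + 1)\<close>, the algebra whose commutant enters \<open>E_proj\<close> at
  index \<open>n\<close>.\<close>

definition Bloc_upto :: "int \<Rightarrow> 'd obs set" where
  "Bloc_upto n = {M. \<exists>L. L \<subseteq> {..n} \<and> local_obs L M}"

lemma Bloc_upto_Bloc: "M \<in> Bloc_upto n \<Longrightarrow> M \<in> Bloc"
  by (auto simp: Bloc_upto_def Bloc_def)

lemma BlocI: "local_obs L M \<Longrightarrow> M \<in> Bloc"
  by (auto simp: Bloc_def)

lemma Bloc_common_support:
  assumes "M \<in> Bloc" "N \<in> Bloc"
  obtains L where "local_obs L M" "local_obs L N"
proof -
  obtain L1 L2 where L: "local_obs L1 M" "local_obs L2 N" using assms by (auto simp: Bloc_def)
  have "finite (L1 \<union> L2)" using L by (auto dest: local_obs_finite)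
  then show ?thesis
    by (intro that[of "L1 \<union> L2"] local_obs_mono[OF L(1)] local_obs_mono[OF L(2)]) auto
qed

lemma Bloc_upto_common_support:
  assumes "M \<in> Bloc_upto n" "N \<in> Bloc_upto n"
  obtains L where "L \<subseteq> {..n}" "local_obs L M" "local_obs L N"
proof -
  obtain L1 L2 where L: "local_obs L1 M" "local_obs L2 N" "L1 \<subseteq> {..n}" "L2 \<subseteq> {..n}"
    using assms by (auto simp: Bloc_upto_def)
  have "finite (L1 \<union> L2)" using L by (auto dest: local_obs_finite)
  then show ?thesis
    using L(3,4) by (intro that[of "L1 \<union> L2"] local_obs_mono[OF L(1)] local_obs_mono[OF L(2)]) auto
qed

lemma Bloc_closed:
  fixes M N :: "'d::finite obs"
  shows "M \<in> Bloc \<Longrightarrow> N \<in> Bloc \<Longrightarrow> obs_add M N \<in> Bloc"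
    and "M \<in> Bloc \<Longrightarrow> N \<in> Bloc \<Longrightarrow> obs_mult M N \<in> Bloc"
    and "M \<in> Bloc \<Longrightarrow> obs_scale c M \<in> Bloc"
    and "M \<in> Bloc \<Longrightarrow> obs_adj M \<in> Bloc"
    and "M \<in> Bloc \<Longrightarrow> shift n M \<in> Bloc"
    and "obs_one \<in> Bloc"
  subgoal by (rule Bloc_common_support[of M N]) (auto intro: BlocI local_obs_add)
  subgoal by (rule Bloc_common_support[of M N]) (auto intro: BlocI local_obs_mult)
  subgoal using local_obs_scale by (auto simp: Bloc_def)
  subgoal using local_obs_adj by (auto simp: Bloc_def)
  subgoal using local_obs_shift by (auto simp: Bloc_def)
  subgoal using local_obs_one[of "{}"] by (auto simp: Bloc_def)
  done

lemma Bloc_upto_closed: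
  fixes M N :: "'d::finite obs"
  shows "M \<in> Bloc_upto n \<Longrightarrow> N \<in> Bloc_upto n \<Longrightarrow> obs_add M N \<in> Bloc_upto n"
    and "M \<in> Bloc_upto n \<Longrightarrow> N \<in> Bloc_upto n \<Longrightarrow> obs_mult M N \<in> Bloc_upto n"
    and "M \<in> Bloc_upto n \<Longrightarrow> obs_scale c M \<in> Bloc_upto n"
    and "M \<in> Bloc_upto n \<Longrightarrow> obs_adj M \<in> Bloc_upto n"
    and "M \<in> Bloc_upto n \<Longrightarrow> shift k M \<in> Bloc_upto (n + k)"
    and "obs_one \<in> Bloc_upto n"
  subgoal by (rule Bloc_upto_common_support[of M n N]) (auto simp: Bloc_upto_def intro: local_obs_add)
  subgoal by (rule Bloc_upto_common_support[of M n N]) (auto simp: Bloc_upto_def intro: local_obs_mult)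
  subgoal using local_obs_scale by (auto simp: Bloc_upto_def)
  subgoal using local_obs_adj by (auto simp: Bloc_upto_def)
  subgoal
  proof -
    assume "M \<in> Bloc_upto n"
    then obtain L where L: "L \<subseteq> {..n}" "local_obs L M" by (auto simp: Bloc_upto_def)
    then have "(\<lambda>j. j + k) ` L \<subseteq> {..n + k}" by auto
    with local_obs_shift[OF L(2)] show ?thesis unfolding Bloc_upto_def by blast
  qed
  subgoal using local_obs_one[of "{}"] by (auto simp: Bloc_upto_def)
  done

lemma Bloc_upto_mono:
  assumes "n \<le> m"
  shows "Bloc_upto n \<subseteq> Bloc_upto m"
proof
  fix M assume "M \<in> Bloc_upto n"
  then obtain L where "L \<subseteq> {..n}" "local_obs L M" by (auto simp: Bloc_upto_def)
  moreover from this(1) have "L \<subseteq> {..m}" using assms by auto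
  ultimately show "M \<in> Bloc_upto m" by (auto simp: Bloc_upto_def)
qed

lemma Bloc_in_some_Bloc_upto:
  assumes "M \<in> Bloc"
  shows "\<exists>n. M \<in> Bloc_upto n"
proof -
  obtain L where L: "local_obs L M" using assms by (auto simp: Bloc_def)
  have "bdd_above L" using local_obs_finite[OF L] by simp
  then obtain n where "L \<subseteq> {..n}" by (auto simp: bdd_above_def)
  with L show ?thesis by (auto simp: Bloc_upto_def)
qed

lemma cscale_eq_0_iff:
  assumes "cplx_struct J"
  shows "cscale J c x = 0 \<longleftrightarrow> c = 0 \<or> x = (0::'h::real_inner)"
proof -
  have "inner (cscale J c x) (cscale J c x) = ((Re c)\<^sup>2 + (Im c)\<^sup>2) * inner x x"
    by (simp add: cscale_def inner_add_left inner_add_right cplx_structD(2,4,5)[OF assms]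
        power2_eq_square algebra_simps)
  then have "cscale J c x = 0 \<longleftrightarrow> (Re c)\<^sup>2 + (Im c)\<^sup>2 = 0 \<or> x = 0"
    by (metis inner_eq_zero_iff mult_eq_0_iff)
  then show ?thesis by (simp add: complex_eq_iff sum_power2_eq_zero_iff)
qed

text \<open>Interpreted once for the given state and once for the product state; only the triviality
  of the intersection of the \<open>K n\<close> is shown separately for each.\<close>

locale GNS_shift =
  fixes w :: "'d::finite obs \<Rightarrow> complex"
    and J :: "'h::{real_inner,complete_space} \<Rightarrow> 'h" and rep :: "'d obs \<Rightarrow> 'h \<Rightarrow> 'h"
    and z :: 'h and S :: "'h \<Rightarrow> 'h"
  assumes gns: "is_GNS w J rep z" and shift_op: "is_shift_op J rep z S"
    and invariant: "translation_invariant w" and unital: "w obs_one = 1"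
    and two_levels: "CARD('d) \<ge> 2"
begin

lemma J: "cplx_struct J" using gns by (simp add: is_GNS_def)

lemma rep_bounded: "M \<in> Bloc \<Longrightarrow> bounded_linear (rep M)"
  and rep_J: "M \<in> Bloc \<Longrightarrow> rep M (J x) = J (rep M x)"
  using gns by (auto simp: is_GNS_def bcl_def)

lemma rep_add: "M \<in> Bloc \<Longrightarrow> N \<in> Bloc \<Longrightarrow> rep (obs_add M N) x = rep M x + rep N x"
  and rep_scale: "M \<in> Bloc \<Longrightarrow> rep (obs_scale c M) x = cscale J c (rep M x)"
  and rep_mult: "M \<in> Bloc \<Longrightarrow> N \<in> Bloc \<Longrightarrow> rep (obs_mult M N) x = rep M (rep N x)"
  and rep_adj: "M \<in> Bloc \<Longrightarrow> inner (rep (obs_adj M) x) y = inner x (rep M y)"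
  and rep_one: "rep obs_one x = x"
  and state_eq: "M \<in> Bloc \<Longrightarrow> w M = cinner J z (rep M z)"
  and cyclic: "closure {rep M z | M. M \<in> Bloc} = UNIV"
  using gns unfolding is_GNS_def by blast+

lemma rep_adj': "M \<in> Bloc \<Longrightarrow> inner x (rep (obs_adj M) y) = inner (rep M x) y"
  using rep_adj[of M y x] by (simp add: inner_commute)

lemma rep_cscale: "M \<in> Bloc \<Longrightarrow> rep M (cscale J c x) = cscale J c (rep M x)"
  using rep_bounded[THEN bounded_linear.linear] rep_J
  by (simp add: cscale_def linear_add linear_scale)

lemma rep_zero: "rep (\<lambda>_ _. 0) x = 0"
proof -
  have *: "(\<lambda>_ _. 0) = obs_scale 0 (obs_one :: 'd obs)" by (simp add: obs_scale_def fun_eq_iff)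
  show ?thesis unfolding * using rep_scale[OF Bloc_closed(6), of 0 x] by (simp add: cscale_def)
qed

text \<open>Locality of the partial sums is part of the induction because additivity of
  \<open>rep\<close> is available on local observables only.\<close>

lemma rep_sum:
  assumes "finite F" "\<And>i. i \<in> F \<Longrightarrow> local_obs L (M i)" "finite L"
  shows "local_obs L (\<lambda>s t. \<Sum>i\<in>F. M i s t) \<and> rep (\<lambda>s t. \<Sum>i\<in>F. M i s t) x = (\<Sum>i\<in>F. rep (M i) x)"
  using assms(1,2)
proof (induction F)
  case empty
  then show ?case by (simp add: rep_zero local_obs_zero[OF assms(3)])
next
  case (insert i F)
  then have IH: "local_obs L (\<lambda>s t. \<Sum>i\<in>F. M i s t)" "rep (\<lambda>s t. \<Sum>i\<in>F. M i s t) x = (\<Sum>i\<in>F. rep (M i) x)"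
    by auto
  have "(\<lambda>s t. \<Sum>i\<in>insert i F. M i s t) = obs_add (M i) (\<lambda>s t. \<Sum>i\<in>F. M i s t)"
    using insert.hyps by (simp add: obs_add_def fun_eq_iff)
  then show ?case
    using insert IH local_obs_add[OF _ IH(1)] rep_add[OF BlocI[of L "M i"] BlocI[OF IH(1)]] by simp
qed

lemma rep_expansion:
  assumes M: "local_obs L M"
  shows "rep M x = (\<Sum>p\<in>configs L \<times> configs L. cscale J (M (fst p) (snd p)) (rep (matrix_unit L (fst p) (snd p)) x))"
proof -
  have fin: "finite L" "finite (configs L \<times> configs L :: ((int \<Rightarrow> 'd) \<times> (int \<Rightarrow> 'd)) set)"
    using local_obs_finite[OF M] finite_configs by auto
  have "rep M x = (\<Sum>p\<in>configs L \<times> configs L. rep (obs_scale (M (fst p) (snd p)) (matrix_unit L (fst p) (snd p))) x)"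
    by (subst matrix_unit_expansion[OF M])
      (rule rep_sum[OF fin(2) local_obs_scale[OF local_obs_matrix_unit[OF fin(1)]] fin(1), THEN conjunct2])
  then show ?thesis by (simp add: rep_scale[OF BlocI[OF local_obs_matrix_unit[OF fin(1)]]])
qed

lemma rep_matrix_unit:
  assumes "finite L"
  shows "rep (matrix_unit L a b) (rep (matrix_unit L b c) x) = rep (matrix_unit L a c) x"
    and "b \<in> configs L \<Longrightarrow> b' \<in> configs L \<Longrightarrow> b \<noteq> b' \<Longrightarrow>
      rep (matrix_unit L a b) (rep (matrix_unit L b' c) x) = 0"
proof -
  note mu = BlocI[OF local_obs_matrix_unit[OF assms]]
  note m = rep_mult[OF mu mu, of a b _ c x, symmetric]
  show "rep (matrix_unit L a b) (rep (matrix_unit L b c) x) = rep (matrix_unit L a c) x"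
    unfolding m matrix_unit_mult by simp
  assume b: "b \<in> configs L" "b' \<in> configs L" "b \<noteq> b'"
  have "\<not> (\<forall>j\<in>L. b j = b' j)" using configs_eqI[OF b(1,2)] b(3) by blast
  then have "obs_mult (matrix_unit L a b) (matrix_unit L b' c) = (\<lambda>_ _. 0)"
    unfolding matrix_unit_mult by (rule if_not_P)
  then show "rep (matrix_unit L a b) (rep (matrix_unit L b' c) x) = 0"
    using m rep_zero by simp
qed

text \<open>The diagonal matrix units of a region sum to the identity.\<close>

lemma eq_0_if_diagonal_units_vanish:
  assumes "finite L" "\<And>a. a \<in> configs L \<Longrightarrow> rep (matrix_unit L a a) x = 0"
  shows "x = 0"
proof -
  have "rep obs_one x = 0"
    unfolding rep_expansion[OF local_obs_one[OF assms(1)]]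
    by (rule sum.neutral) (auto simp: obs_one_def assms(2) cscale_def linear_0[OF cplx_structD(1)[OF J]])
  then show ?thesis by (simp add: rep_one)
qed

lemma inner_orbit: "M \<in> Bloc \<Longrightarrow> N \<in> Bloc \<Longrightarrow> inner (rep M z) (rep N z) = Re (w (obs_mult (obs_adj M) N))"
  by (simp add: state_eq Bloc_closed cinner_def rep_mult rep_adj')

lemma norm_z: "norm z = 1"
proof -
  have "Complex (inner z z) (- inner z (J z)) = 1"
    using state_eq[OF Bloc_closed(6)] unital by (simp add: cinner_def rep_one)
  then show ?thesis by (simp add: norm_eq_1 complex_eq_iff)
qed

lemma S_bcl: "bcl J S" and S_orbit: "M \<in> Bloc \<Longrightarrow> S (rep M z) = rep (shift 1 M) z"
  using shift_op by (auto simp: is_shift_op_def)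

lemma S_bounded: "bounded_linear S" using S_bcl by (simp add: bcl_def)

lemma S_z: "S z = z"
  using S_orbit[OF Bloc_closed(6)] by (simp add: rep_one shift_one)

text \<open>On orbit vectors the inner product is a value of \<open>w\<close>, and translation
  invariance preserves it; density extends the identity in one argument at a time.\<close>

lemma S_inner: "inner (S x) (S y) = inner x y"
proof -
  let ?D = "{rep M z | M. M \<in> Bloc}"
  have cont: "continuous_on UNIV S" using S_bounded by (simp add: linear_continuous_on)
  have 1: "inner (S x) (S y) = inner x y" if xy: "x \<in> ?D" "y \<in> ?D" for x y
  proof -
    obtain M N where MN: "M \<in> Bloc" "N \<in> Bloc" "x = rep M z" "y = rep N z" using xy by blast
    have "inner (S x) (S y) = Re (w (shift 1 (obs_mult (obs_adj M) N)))"
      using MN by (simp add: S_orbit inner_orbit Bloc_closed shift_mult shift_adj)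
    also have "\<dots> = inner x y"
      using MN invariant by (simp add: translation_invariant_def inner_orbit Bloc_closed)
    finally show ?thesis .
  qed
  have 2: "inner (S x) (S y) = inner x y" if "x \<in> ?D" for x y
  proof -
    have "closed {y. inner (S x) (S y) = inner x y}"
      by (intro closed_Collect_eq continuous_intros cont)
    moreover have "?D \<subseteq> {y. inner (S x) (S y) = inner x y}" using 1[OF that] by blast
    ultimately have "closure ?D \<subseteq> {y. inner (S x) (S y) = inner x y}" by (rule closure_minimal[rotated])
    then show ?thesis using cyclic by blast
  qed
  have "closed {x. inner (S x) (S y) = inner x y}"
    by (intro closed_Collect_eq continuous_intros cont)
  moreover have "?D \<subseteq> {x. inner (S x) (S y) = inner x y}" using 2 by blast
  ultimately have "closure ?D \<subseteq> {x. inner (S x) (S y) = inner x y}" by (rule closure_minimal[rotated])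
  then show ?thesis using cyclic by blast
qed

section \<open>The half-chain subspaces and the action of the shift on them\<close>

definition orbit :: "int \<Rightarrow> 'h set" where "orbit n = {rep M z | M. M \<in> Bloc_upto n}"

definition K :: "int \<Rightarrow> 'h set" where "K n = closure (orbit n)"

lemma orbitI: "M \<in> Bloc_upto n \<Longrightarrow> rep M z \<in> orbit n"
  by (auto simp: orbit_def)

lemma orbit_in_K: "M \<in> Bloc_upto n \<Longrightarrow> rep M z \<in> K n"
  using orbitI closure_subset by (auto simp: K_def)

lemma orbit_subspace: "subspace (orbit n)"
  unfolding subspace_def
proof (intro conjI ballI allI)
  show "0 \<in> orbit n"
    using orbitI[OF Bloc_upto_closed(3)[OF Bloc_upto_closed(6), of 0 n]]
    by (simp add: rep_scale Bloc_closed cscale_def)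
  show "x + y \<in> orbit n" if xy: "x \<in> orbit n" "y \<in> orbit n" for x y
  proof -
    obtain M N where MN: "M \<in> Bloc_upto n" "N \<in> Bloc_upto n" "x = rep M z" "y = rep N z"
      using xy by (auto simp: orbit_def)
    then show ?thesis
      using orbitI[OF Bloc_upto_closed(1)[OF MN(1,2)]] by (simp add: rep_add Bloc_upto_Bloc)
  qed
  show "c *\<^sub>R x \<in> orbit n" if x: "x \<in> orbit n" for c x
  proof -
    obtain M where M: "M \<in> Bloc_upto n" "x = rep M z" using x by (auto simp: orbit_def)
    then show ?thesis
      using orbitI[OF Bloc_upto_closed(3)[OF M(1), of "of_real c"]]
      by (simp add: rep_scale Bloc_upto_Bloc cscale_def)
  qed
qed

lemma orbit_J: "x \<in> orbit n \<Longrightarrow> J x \<in> orbit n"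
proof -
  assume "x \<in> orbit n"
  then obtain M where M: "M \<in> Bloc_upto n" "x = rep M z" by (auto simp: orbit_def)
  then have "rep (obs_scale \<i> M) z = J x" by (simp add: rep_scale Bloc_upto_Bloc cscale_def)
  then show "J x \<in> orbit n" using orbitI[OF Bloc_upto_closed(3)[OF M(1), of \<i>]] by simp
qed

lemma K_image_subset:
  assumes "bounded_linear T" "\<And>x. x \<in> orbit n \<Longrightarrow> T x \<in> orbit m" "x \<in> K n"
  shows "T x \<in> K m"
proof -
  have "T ` closure (orbit n) \<subseteq> closure (orbit m)"
    using assms(1,2) closure_subset
    by (intro image_closure_subset linear_continuous_on) auto
  with assms(3) show ?thesis by (auto simp: K_def)
qed

lemma K_subspace: "subspace (K n)" and K_closed: "closed (K n)"
  by (auto simp: K_def subspace_closure orbit_subspace)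

lemma K_J: "x \<in> K n \<Longrightarrow> J x \<in> K n"
  using K_image_subset[OF cplx_structD(7)[OF J] orbit_J] .

lemma K_rep: "M \<in> Bloc_upto n \<Longrightarrow> x \<in> K n \<Longrightarrow> rep M x \<in> K n"
proof (rule K_image_subset[OF rep_bounded[OF Bloc_upto_Bloc]])
  fix x assume M: "M \<in> Bloc_upto n" and "x \<in> orbit n"
  then obtain N where N: "N \<in> Bloc_upto n" "x = rep N z" by (auto simp: orbit_def)
  then have "rep (obs_mult M N) z = rep M x" using M by (simp add: rep_mult Bloc_upto_Bloc)
  then show "rep M x \<in> orbit n" using orbitI[OF Bloc_upto_closed(2)[OF M N(1)]] by simp
qed auto

lemma K_Suc: "K n \<subseteq> K (n + 1)"
proof -
  have "orbit n \<subseteq> orbit (n + 1)" using Bloc_upto_mono[of n "n + 1"] by (auto simp: orbit_def)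
  then show ?thesis unfolding K_def by (rule closure_mono)
qed

lemma z_in_K: "z \<in> K n"
  using orbit_in_K[OF Bloc_upto_closed(6)] by (simp add: rep_one)

lemma K_dense: "closure (\<Union>n. K n) = UNIV"
proof -
  have "{rep M z | M. M \<in> Bloc} \<subseteq> (\<Union>n. K n)"
    using Bloc_in_some_Bloc_upto orbit_in_K by blast
  from closure_mono[OF this] show ?thesis using cyclic by auto
qed

lemma S_closed_image: "subspace A \<Longrightarrow> closed A \<Longrightarrow> closed (S ` A)"
proof -
  assume A: "subspace A" "closed A"
  have "norm (S x) = norm x" for x using S_inner by (simp add: norm_eq_sqrt_inner)
  then have "complete (S ` A)"
    using A by (intro complete_isometric_image[of 1] S_bounded) (auto simp: complete_eq_closed)
  then show ?thesis by (simp add: complete_eq_closed)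
qed

text \<open>The range of an isometry is closed, and it contains the orbit since every local
  observable is the translate of another.\<close>

lemma S_surj: "surj S"
proof -
  have "closed (range S)" by (rule S_closed_image) auto
  moreover have "{rep M z | M. M \<in> Bloc} \<subseteq> range S"
  proof
    fix x assume "x \<in> {rep M z | M. M \<in> Bloc}"
    then obtain M where M: "M \<in> Bloc" "x = rep M z" by blast
    have "S (rep (shift (- 1) M) z) = x"
      using M by (simp add: S_orbit Bloc_closed shift_shift shift_0)
    then show "x \<in> range S" by blast
  qed
  ultimately have "closure {rep M z | M. M \<in> Bloc} \<subseteq> range S" by (rule closure_minimal[rotated])
  then show ?thesis using cyclic by blast
qed

lemma S_K: "S ` K n = K (n + 1)"
proof
  have "S x \<in> orbit (n + 1)" if x: "x \<in> orbit n" for x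
  proof -
    obtain M where M: "M \<in> Bloc_upto n" "x = rep M z" using x by (auto simp: orbit_def)
    then have "S x = rep (shift 1 M) z" by (simp add: S_orbit Bloc_upto_Bloc)
    with Bloc_upto_closed(5)[OF M(1), of 1] show ?thesis by (auto simp: orbit_def)
  qed
  then show "S ` K n \<subseteq> K (n + 1)" using K_image_subset[OF S_bounded] by blast
  have "orbit (n + 1) \<subseteq> S ` K n"
  proof
    fix x assume "x \<in> orbit (n + 1)"
    then obtain M where M: "M \<in> Bloc_upto (n + 1)" "x = rep M z" by (auto simp: orbit_def)
    then have "S (rep (shift (- 1) M) z) = x"
      by (simp add: S_orbit Bloc_closed Bloc_upto_Bloc shift_shift shift_0)
    moreover have "rep (shift (- 1) M) z \<in> K n"
      using orbit_in_K[OF Bloc_upto_closed(5)[OF M(1), of "- 1"]] by simp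
    ultimately show "x \<in> S ` K n" by blast
  qed
  then show "K (n + 1) \<subseteq> S ` K n"
    unfolding K_def[of "n + 1"] using S_closed_image[OF K_subspace K_closed] by (rule closure_minimal)
qed

text \<open>There are countably many finite regions, each with finitely many matrix units, whose
  orbit vectors span over the complex numbers; the \<open>J\<close>-images make up for the real
  span.\<close>

lemma separable: "\<exists>G::'h set. countable G \<and> closure (span G) = UNIV"
proof -
  define P where "P = (SIGMA L:Collect finite. (configs L :: (int \<Rightarrow> 'd) set) \<times> (configs L :: (int \<Rightarrow> 'd) set))"
  define g where "g = (\<lambda>(L, a, b :: int \<Rightarrow> 'd). rep (matrix_unit L a b) z)"
  let ?G = "g ` P \<union> J ` g ` P"
  have "countable P"
    unfolding P_def
    by (rule countable_SIGMA[OF countable_Collect_finite])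
      (simp add: countable_finite finite_configs)
  then have "countable ?G" by simp
  moreover have "{rep M z | M. M \<in> Bloc} \<subseteq> span ?G"
  proof
    fix x assume "x \<in> {rep M z | M. M \<in> Bloc}"
    then obtain M L where M: "local_obs L M" "x = rep M z" by (auto simp: Bloc_def)
    have "rep (matrix_unit L a b) z \<in> g ` P" if "a \<in> configs L" "b \<in> configs L" for a b
      using that local_obs_finite[OF M(1)] by (force simp: P_def g_def)
    then show "x \<in> span ?G"
      unfolding M(2) rep_expansion[OF M(1)] cscale_def
      by (intro span_sum span_add span_scale span_base) auto
  qed
  then have "closure (span ?G) = UNIV" using closure_mono cyclic by blast
  ultimately show ?thesis by blast
qed

text \<open>Otherwise the state would be a character of a full matrix algebra.\<close>

lemma not_one_dimensional: "\<not> (\<forall>x. x = cscale J (cinner J z x) z)"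
proof
  assume one: "\<forall>x. x = cscale J (cinner J z x) z"
  define L :: "int set" where "L = {0}"
  have fin: "finite L" by (simp add: L_def)
  note mu = BlocI[OF local_obs_matrix_unit[OF fin]]
  have z0: "z \<noteq> 0" using norm_z by auto
  \<comment> \<open>An off-diagonal unit squares to zero but acts on \<open>z\<close> as a scalar,
    so the scalar vanishes.\<close>
  have off: "rep (matrix_unit L a b) z = 0" if ab: "a \<in> configs L" "b \<in> configs L" "a \<noteq> b" for a b
  proof -
    define c where "c = cinner J z (rep (matrix_unit L a b) z)"
    have rz: "rep (matrix_unit L a b) z = cscale J c z" using one c_def by blast
    have "rep (matrix_unit L a b) (rep (matrix_unit L a b) z) = 0"
      using rep_matrix_unit(2)[OF fin ab(2,1)] ab(3) by blast
    then have "cscale J c (cscale J c z) = 0" by (simp add: rz rep_cscale[OF mu])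
    then have "c = 0" using z0 by (simp add: cscale_eq_0_iff[OF J])
    then show ?thesis by (simp add: rz cscale_def)
  qed
  have "rep (matrix_unit L b b) z = 0" if b: "b \<in> configs L" for b
  proof -
    have "card (configs L :: (int \<Rightarrow> 'd) set) \<ge> 2"
      using two_levels by (simp add: card_configs[OF fin]) (simp add: L_def)
    then have "\<not> configs L \<subseteq> {b}"
      using card_mono[of "{b}" "configs L"] by auto
    then obtain a where a: "a \<in> configs L" "a \<noteq> b" by blast
    \<comment> \<open>With a second configuration available, the diagonal unit factors through an
      off-diagonal one.\<close>
    have "rep (matrix_unit L b b) z = rep (matrix_unit L b a) (rep (matrix_unit L a b) z)"
      by (simp add: rep_matrix_unit(1)[OF fin])
    also have "\<dots> = 0" using off[OF a(1) b a(2)] linear_0[OF bounded_linear.linear[OF rep_bounded[OF mu]]] by simp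
    finally show ?thesis .
  qed
  then have "z = 0" using eq_0_if_diagonal_units_vanish[OF fin] by blast
  with z0 show False by simp
qed

lemma ex_bilateral_shift_basis:
  assumes Inter: "\<And>x. (\<And>n. x \<in> K n) \<Longrightarrow> x = cscale J (cinner J z x) z"
  shows "\<exists>e. bilateral_shift_basis J S z e"
proof -
  interpret shift_filtration J S z K
  proof (rule shift_filtration.intro)
    show "J x \<in> K n" if "x \<in> K n" for x n using that by (rule K_J)
    show "x = cscale J (cinner J z x) z" if "\<And>n. x \<in> K n" for x using that by (rule Inter)
  qed (rule J S_bcl S_inner S_surj S_z norm_z K_subspace K_closed K_Suc S_K K_dense z_in_K)+
  \<comment> \<open>\<open>K 0\<close> and \<open>K 1\<close> are invariant under a self-adjoint
    family of operators, so the orthogonal complement of one in the other is invariant too.\<close>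
  have W_rep: "rep M x \<in> W" if M: "M \<in> Bloc_upto 0" and x: "x \<in> W" for M x
  proof -
    have "M \<in> Bloc_upto 1" using M Bloc_upto_mono[of 0 1] by auto
    then have "rep M x \<in> K 1" using K_rep x by (auto simp: W_def)
    moreover have "inner (rep M x) y = 0" if "y \<in> K 0" for y
      using K_rep[OF Bloc_upto_closed(4)[OF M] that] x rep_adj'[OF Bloc_upto_Bloc[OF M], of x y]
      by (auto simp: W_def)
    ultimately show ?thesis by (simp add: W_def)
  qed
  obtain x where x: "x \<in> W" "x \<noteq> 0"
  proof (rule ccontr)
    assume no: "\<not> thesis"
    then have W0: "u = 0" if "u \<in> W" for u using that \<open>\<And>x. x \<in> W \<Longrightarrow> x \<noteq> 0 \<Longrightarrow> thesis\<close> by blast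
    have "K 1 \<subseteq> K 0"
    proof
      fix x assume x: "x \<in> K 1"
      obtain p where p: "p \<in> K 0" "\<And>u. u \<in> K 0 \<Longrightarrow> inner (x - p) u = 0"
        using closed_subspace_projection[OF K_subspace K_closed] by metis
      have "x - p \<in> W"
        using p x K_Suc[of 0] K_subspace[of 1] by (auto simp: W_def intro: subspace_diff)
      then show "x \<in> K 0" using W0 p(1) by fastforce
    qed
    then have K10: "K 1 = K 0" using K_Suc[of 0] by auto
    have Kn: "K n = K 0" for n
    proof -
      \<comment> \<open>Both sides are images under \<open>S_pow n\<close>, of \<open>K 1\<close>
        and \<open>K 0\<close>.\<close>
      have step: "K (1 + n) = K n" for n using S_pow_K[of n 1] S_pow_K[of n 0] K10 by simp
      show ?thesis
      proof (induction n rule: int_induct[where k=0])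
        case base then show ?case by simp
      next
        case (step1 i) then show ?case using step[of i] by (simp add: add.commute)
      next
        case (step2 i) then show ?case using step[of "i - 1"] by simp
      qed
    qed
    then have "(\<Union>n. K n) = K 0" by blast
    then have "K 0 = UNIV" using K_dense K_closed[of 0] by simp
    with Kn have "K n = UNIV" for n by blast
    then show False using Inter not_one_dimensional by blast
  qed
  \<comment> \<open>\<open>W\<close> carries a nonzero representation of the algebra of the sites \<open>\<le> 0\<close>; the matrix units of \<open>n\<close>
    sites already produce \<open>d ^ n\<close> orthogonal vectors from a single one.\<close>
  have inf: "\<exists>A\<subseteq>W. finite A \<and> card A > n \<and> pairwise orthogonal A \<and> 0 \<notin> A" for n
  proof -
    \<comment> \<open>Exactly \<open>n\<close> sites; for \<open>n = 0\<close> the region is empty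
      and the single vector obtained still exceeds the count.\<close>
    define L where "L = {- int n + 1..0}"
    have fin: "finite L" by (simp add: L_def)
    note mu = BlocI[OF local_obs_matrix_unit[OF fin]]
    have mu0: "matrix_unit L a b \<in> Bloc_upto 0" for a b :: "int \<Rightarrow> 'd"
    proof -
      have "L \<subseteq> {..0}" by (auto simp: L_def)
      with local_obs_matrix_unit[OF fin] show ?thesis unfolding Bloc_upto_def by blast
    qed
    obtain b where b: "b \<in> configs L" "rep (matrix_unit L b b) x \<noteq> 0"
      using eq_0_if_diagonal_units_vanish[OF fin] x(2) by blast
    \<comment> \<open>One column of matrix units with fixed source \<open>b\<close>: different
      targets \<open>a\<close> give orthogonal vectors, and each is nonzero because it can be mapped
      back to the nonzero vector at \<open>b\<close>.\<close>
    let ?v = "\<lambda>a. rep (matrix_unit L a b) x"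
    have nz: "?v a \<noteq> 0" for a
    proof
      assume "?v a = 0"
      then have "rep (matrix_unit L b a) (?v a) = 0"
        using linear_0[OF bounded_linear.linear[OF rep_bounded[OF mu]]] by simp
      then show False using b(2) by (simp add: rep_matrix_unit(1)[OF fin])
    qed
    have orth: "inner (?v a) (?v c) = 0" if "a \<in> configs L" "c \<in> configs L" "a \<noteq> c" for a c
    proof -
      have "rep (matrix_unit L b a) (?v c) = 0" by (rule rep_matrix_unit(2)[OF fin that])
      then show ?thesis using rep_adj[OF mu, of b a x "?v c"] by (simp add: matrix_unit_adj)
    qed
    have "inj_on ?v (configs L)"
      using orth nz by (intro inj_onI) (metis inner_eq_zero_iff)
    then have "card (?v ` configs L) = CARD('d) ^ n"
      by (simp add: card_image card_configs[OF fin]) (simp add: L_def)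
    moreover have "n < CARD('d) ^ n"
      using two_levels less_exp[of n] power_mono[of 2 "CARD('d)" n] by linarith
    moreover have "?v ` configs L \<subseteq> W" using W_rep[OF mu0 x(1)] by blast
    moreover have "pairwise orthogonal (?v ` configs L)"
      using orth by (auto simp: pairwise_def orthogonal_def)
    ultimately show ?thesis
      using nz finite_configs[OF fin] by (intro exI[of _ "?v ` configs L"]) auto
  qed
  obtain G :: "'h set" where G: "countable G" "closure (span G) = UNIV" using separable by blast
  obtain b :: "nat \<Rightarrow> 'h" where "range b \<subseteq> W" "complex_orthonormal J b"
    "\<forall>x\<in>W. (\<forall>i. inner x (b i) = 0 \<and> inner x (J (b i)) = 0) \<longrightarrow> x = 0"
    by (rule complex_orthonormal_basis_nat[OF J W_subspace W_J G inf])
  then show ?thesis using S_pow_bilateral_shift_basis by blast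
qed

text \<open>By locality \<open>K n\<close> lies in the range of \<open>E_proj J rep z n\<close>.\<close>

lemma Inter_K_kolmogorov:
  assumes kol: "kolmogorov J rep z" and x: "\<And>n. x \<in> K n"
  shows "x = cscale J (cinner J z x) z"
proof -
  have E: "E_proj J rep z n x = x" for n
  proof -
    let ?C = "{T z | T. T \<in> commutant_R J rep n}"
    have "orbit n \<subseteq> ?C"
    proof
      fix y assume "y \<in> orbit n"
      then obtain M where M: "M \<in> Bloc_upto n" "y = rep M z" by (auto simp: orbit_def)
      then obtain L where L: "L \<subseteq> {..n}" "local_obs L M" by (auto simp: Bloc_upto_def)
      have "rep M (rep N u) = rep N (rep M u)" if NR: "N \<in> Bloc_from (n + 1)" for N u
      proof -
        obtain L' where L': "L' \<subseteq> {n + 1..}" "local_obs L' N" using NR by (auto simp: Bloc_from_def)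
        have "L \<inter> L' = {}" using L(1) L'(1) by force
        from obs_mult_commute_disjoint[OF L(2) L'(2) this] show ?thesis
          using rep_mult[OF BlocI[OF L(2)] BlocI[OF L'(2)], of u]
            rep_mult[OF BlocI[OF L'(2)] BlocI[OF L(2)], of u] by simp
      qed
      moreover have "bcl J (rep M)"
        using rep_bounded rep_J Bloc_upto_Bloc[OF M(1)] by (simp add: bcl_def)
      ultimately show "y \<in> ?C" using M(2) by (auto simp: commutant_R_def)
    qed
    then have xC: "x \<in> closure ?C" using x[of n] closure_mono unfolding K_def by blast
    have lin: "linear (rep N)" if "N \<in> Bloc_from (n + 1)" for N
      using that rep_bounded[THEN bounded_linear.linear] by (auto simp: Bloc_from_def Bloc_def)
    \<comment> \<open>\<open>orth_proj\<close> is a definite description; its uniqueness needs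
      differences to stay in the closure of \<open>?C\<close>.\<close>
    have "subspace ?C"
      unfolding subspace_def
    proof (intro conjI ballI allI)
      have "(\<lambda>_. 0) \<in> commutant_R J rep n"
        using lin by (auto simp: commutant_R_def bcl_def linear_0 linear_0[OF cplx_structD(1)[OF J]])
      then show "0 \<in> ?C" by (intro CollectI exI[of _ "\<lambda>_. 0"]) auto
      show "u + v \<in> ?C" if uv: "u \<in> ?C" "v \<in> ?C" for u v
      proof -
        obtain T T' where T: "T \<in> commutant_R J rep n" "T' \<in> commutant_R J rep n" "u = T z" "v = T' z"
          using uv by blast
        then have "(\<lambda>x. T x + T' x) \<in> commutant_R J rep n"
          using lin by (auto simp: commutant_R_def bcl_def linear_add linear_add[OF cplx_structD(1)[OF J]]
              intro: bounded_linear_add)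
        then show ?thesis using T(3,4) by (intro CollectI exI[of _ "\<lambda>x. T x + T' x"]) auto
      qed
      show "c *\<^sub>R u \<in> ?C" if u: "u \<in> ?C" for c u
      proof -
        obtain T where T: "T \<in> commutant_R J rep n" "u = T z"
          using u by blast
        then have "(\<lambda>x. c *\<^sub>R T x) \<in> commutant_R J rep n"
          using lin by (auto simp: commutant_R_def bcl_def linear_scale linear_scale[OF cplx_structD(1)[OF J]]
              intro: bounded_linear_const_scaleR)
        then show ?thesis using T(2) by (intro CollectI exI[of _ "\<lambda>x. c *\<^sub>R T x"]) auto
      qed
    qed
    then have sub: "subspace (closure ?C)" by (rule subspace_closure)
    show ?thesis
      unfolding E_proj_def orth_proj_def
    proof (rule the_equality)
      show "x \<in> closure ?C \<and> (\<forall>u\<in>closure ?C. inner (x - x) u = 0)" using xC by simp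
      fix y assume y: "y \<in> closure ?C \<and> (\<forall>u\<in>closure ?C. inner (x - y) u = 0)"
      then have "inner (x - y) (x - y) = 0" using subspace_diff[OF sub xC] by blast
      then show "y = x" by simp
    qed
  qed
  \<comment> \<open>A vector fixed by all projections gives a constant family, whose limit is
    unique.\<close>
  have "((\<lambda>n::int. x) \<longlongrightarrow> cscale J (cinner J z x) z) at_bot"
    using kol[unfolded kolmogorov_def, rule_format, of x] unfolding E .
  then show ?thesis
    using tendsto_const_iff[OF trivial_limit_at_bot_linorder] by metis
qed

text \<open>If the support of \<open>M\<close> lies to the right of that of \<open>N\<close>,
  factorization says that \<open>rep M z\<close> is orthogonal to \<open>rep N z\<close> minus its
  component along \<open>z\<close>. This passes to the closure, and \<open>x\<close> lies far enough
  to the left for every \<open>M\<close>, so \<open>x\<close> minus its component along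
  \<open>z\<close> is orthogonal to a dense set.\<close>

lemma Inter_K_product:
  assumes fac: "\<And>M N L1 L2. \<lbrakk>local_obs L1 M; local_obs L2 N; L1 \<inter> L2 = {}\<rbrakk> \<Longrightarrow> w (obs_mult M N) = w M * w N"
    and x: "\<And>n. x \<in> K n"
  shows "x = cscale J (cinner J z x) z"
proof -
  let ?f = "\<lambda>y. y - cscale J (cinner J z y) z"
  have cont: "continuous_on UNIV ?f"
    unfolding cscale_def cinner_def complex.sel
    by (intro continuous_intros linear_continuous_on[OF cplx_structD(7)[OF J]])
  have "inner (rep M z) (?f x) = 0" if M: "M \<in> Bloc" for M
  proof -
    obtain L where L: "local_obs L M" using M by (auto simp: Bloc_def)
    have "bdd_below L" using local_obs_finite[OF L] by simp
    \<comment> \<open>The cut \<open>m\<close> depends on \<open>M\<close>, which is harmless since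
      \<open>x\<close> lies in \<open>K (m - 1)\<close> for every \<open>m\<close>.\<close>
    then obtain m where m: "\<And>j. j \<in> L \<Longrightarrow> m \<le> j" by (auto simp: bdd_below_def)
    have "inner (rep M z) (?f y) = 0" if y: "y \<in> orbit (m - 1)" for y
    proof -
      obtain N L' where N: "y = rep N z" "local_obs L' N" "L' \<subseteq> {..m - 1}"
        using y by (auto simp: orbit_def Bloc_upto_def)
      have NB: "N \<in> Bloc" using N(2) by (rule BlocI)
      have "L \<inter> L' = {}" using m N(3) by force
      then have "inner (rep M z) y = Re (w (obs_adj M) * w N)"
        using fac[OF local_obs_adj[OF L] N(2)] by (simp add: N(1) inner_orbit M NB)
      moreover have "w (obs_adj M) = Complex (inner (rep M z) z) (- inner (rep M z) (J z))"
        using rep_adj'[OF M, of z "J z"]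
        by (simp add: state_eq Bloc_closed M cinner_def rep_adj' rep_J[symmetric])
      ultimately show ?thesis
        by (simp add: N(1) state_eq[OF NB, symmetric] inner_diff_right cscale_def inner_add_right algebra_simps)
    qed
    moreover have "closed {y. inner (rep M z) (?f y) = 0}"
      by (intro closed_Collect_eq continuous_on_inner continuous_on_const cont)
    ultimately have "closure (orbit (m - 1)) \<subseteq> {y. inner (rep M z) (?f y) = 0}"
      by (intro closure_minimal) auto
    then show ?thesis using x[of "m - 1"] by (auto simp: K_def)
  qed
  then have "inner (?f x) (?f x) = 0"
    using orthogonal_closure[of "{rep M z | M. M \<in> Bloc}" "?f x" "?f x"] cyclic
    by (auto simp: inner_commute)
  then show ?thesis by simp
qed

end

theorem theorem2p3:
  fixes w :: "'d::finite obs \<Rightarrow> complex"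
    and lam :: "complex ^ 'd"
    and J1 :: "'h1::{real_inner,complete_space} \<Rightarrow> 'h1" and pi1 :: "'d obs \<Rightarrow> 'h1 \<Rightarrow> 'h1"
    and z1 :: 'h1 and S1 :: "'h1 \<Rightarrow> 'h1"
    and J2 :: "'h2::{real_inner,complete_space} \<Rightarrow> 'h2" and pi2 :: "'d obs \<Rightarrow> 'h2 \<Rightarrow> 'h2"
    and z2 :: 'h2 and S2 :: "'h2 \<Rightarrow> 'h2"
  assumes "CARD('d) \<ge> 2"
    and "is_state w" and "translation_invariant w"
    and "is_GNS w J1 pi1 z1" and "is_shift_op J1 pi1 z1 S1"
    and "kolmogorov J1 pi1 z1"
    and "norm lam = 1"
    and "is_GNS (product_state lam) J2 pi2 z2" and "is_shift_op J2 pi2 z2 S2"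
  shows "\<exists>U. unitary_map J1 J2 U \<and> U z1 = z2 \<and> U \<circ> S1 = S2 \<circ> U"
proof -
  have u1: "w obs_one = 1" using assms(2) by (simp add: is_state_def)
  interpret A: GNS_shift w J1 pi1 z1 S1
    by unfold_locales (fact assms u1)+
  have u2: "product_state lam obs_one = 1"
    using product_state_eq[OF assms(7) local_obs_one, of "{}"] product_value_one[OF assms(7), of "{}"] by simp
  interpret B: GNS_shift "product_state lam" J2 pi2 z2 S2
    by unfold_locales (fact assms u2 product_state_translation_invariant[OF assms(7)])+
  obtain e1 where e1: "bilateral_shift_basis J1 S1 z1 e1"
    using A.ex_bilateral_shift_basis[OF A.Inter_K_kolmogorov[OF assms(6)]] by blast
  have "x = cscale J2 (cinner J2 z2 x) z2" if "\<And>n. x \<in> B.K n" for x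
    using product_state_mult_disjoint[OF assms(7)] that by (rule B.Inter_K_product)
  then obtain e2 where e2: "bilateral_shift_basis J2 S2 z2 e2"
    using B.ex_bilateral_shift_basis by metis
  show ?thesis
    by (rule bilateral_shifts_unitarily_equivalent[OF A.J A.S_bcl e1 B.J B.S_bcl e2])
qed

end
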